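(* Consider the Sherrington–Kirkpatrick model with Hamiltonian $$\mathcal H_n(\mathbf X^n;\boldsymbol\sigma)=-\sum_{1\le i<j\le n}X_{n,(i,j)}\sigma_i\sigma_j,$$ where the disorder variables $\mathbf X^n=\{X_{n,(i,j)}:1\le i<j\le n\}$ are i.i.d. with common distribution $\mathcal P$ on $\mathbb R$ having a density $f$ and zero mean, and satisfying the Langevin assumption of the context for a pair $(\rho,g)$ such that $g^{(1)}(Y)\ne0$ almost surely when $Y\sim\mathcal Q_\rho$. Further assume that $\mathcal P$ is a sub-Gamma distribution. Then the problem sequence of minimizing $\mathcal H_n(\mathbf X^n;\boldsymbol\sigma)$ over $\boldsymbol\sigma\in\mathcal S_n$ is stable under small perturbations with perturbation blocks $\mathcal J_n=\{J_{n,i}:i\in[n]\}$, where $J_{n,i}=\{(i,j):i<j\le n\}\cup\{(j,i):1\le j<i\}$ for all $i\in[n]$.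
   Context: Parameter space: $\mathcal S_n=\{\boldsymbol\sigma=(\sigma_1,\dots,\sigma_n):\sigma_1=+1,\ \sigma_i\in\{+1,-1\}\text{ for }2\le i\le n\}$ (one representative of each pair $\pm\boldsymbol\sigma$), with normalized Hamming metric $d_n(\boldsymbol\sigma,\boldsymbol\sigma')=\frac1n\sum_{i=1}^n\mathbf 1(\sigma_i\ne\sigma_i')$. The input index set is $I_n=\{(i,j):1\le i<j\le n\}$. The minimizer over $\mathcal S_n$ is almost surely unique, denoted $\widehat{\boldsymbol\sigma}(\mathbf X^n)$. $[n]=\{1,\dots,n\}$. Sub-Gamma: an integrable real $X$ is in $\mathscr G(\sigma^2,c)$ if $\log\mathbb E\exp[\lambda(X-\mathbb EX)]\le\lambda^2\sigma^2/(2(1-c|\lambda|))$ for all $|\lambda|<1/c$ (all $\lambda$ if $c=0$); a distribution is sub-Gamma if a variable with that law is in $\mathscr G(\sigma^2,c)$ for some $\sigma^2,c\ge0$. Langevin assumption (one-dimensional case) on $\mathcal P$ for the pair $(\rho,g)$, $\rho,g:\mathbb R\to\mathbb R$: (1) $\exp(-\rho)$ is integrable; (2) $\rho$ is Lebesgue-a.e. differentiable with Lipschitz derivative, or (2)$'$ $\rho$ is twice continuously differentiable and $(\rho')^2-\frac12\rho''$ is bounded below, or (2)$''$ $\rho$ is twice continuously differentiable and there are $a,b\in\mathbb R$ with $x\rho'(x)\ge-ax^2-b$ for all $x$ (any one suffices); (3) if $Y$ has density proportional to $\exp(-\rho)$, then $\rho'(Y)\in\mathscr G(\sigma^2,c)$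 for some $\sigma^2>0$, $c\ge0$; (4) $g$ has uniformly bounded first and second derivatives and $g(Y)\sim\mathcal P$. $\mathcal Q_\rho$ is the law with density proportional to $\exp(-\rho)$; $g^{(1)}$ is the derivative of $g$. Stability. $\mathcal J_n=\{J_{n,l}:l\in\mathcal L_n\}$ is a finite family of subsets of $I_n$ with union $I_n$; $m_n=\operatorname{card}(\mathcal L_n)$. For each $l$, $\mathbf X^{n,l}$ is an independent copy of $\mathbf X^n$ (no further assumption on the joint law over $l$), and $\mathbf X^n_l$ is $\mathbf X^n$ with the coordinates in $J_{n,l}$ replaced by those of $\mathbf X^{n,l}$. For a metric $\mathsf d$, $P(T,\mathsf d,\varepsilon)$ is the largest cardinality of a subset of $T$ with pairwise distances $>\varepsilon$. With $\mathcal O_{n,A}=\{\widehat{\boldsymbol\sigma}(\mathbf X^n_l):l\in A\}$, the sequence is stable under small perturbations with perturbation blocks $\mathcal J_n$ if for any $\varepsilon,\delta>0$ there is $M(\varepsilon,\delta)<\infty$ with $\limsup_{n\to\infty}\mathbb P[\min_{A\subseteq\mathcal L_n:|A|>(1-\varepsilon)m_n}P(\mathcal O_{n,A},d_n,\varepsilon)\ge M(\varepsilon,\delta)]\le\delta$. *)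

theory Defs
  imports "HOL-Probability.Probability"
begin

section \<open>Sub-Gamma random variables and the Langevin assumption\<close>

text \<open>The argument \<open>v\<close> is the variance proxy, written sigma squared in the literature.
  Finiteness of the exponential moments is an explicit conjunct because the Bochner integral
  of a non-integrable function is 0.\<close>

definition sub_gamma :: "'w measure \<Rightarrow> ('w \<Rightarrow> real) \<Rightarrow> real \<Rightarrow> real \<Rightarrow> bool" where
  "sub_gamma M X v c \<longleftrightarrow>
     0 \<le> v \<and> 0 \<le> c \<and> integrable M X \<and>
     (\<forall>t. c = 0 \<or> \<bar>t\<bar> < 1 / c \<longrightarrow>
        integrable M (\<lambda>\<omega>. exp (t * (X \<omega> - integral\<^sup>L M X))) \<and>
        ln (\<integral>\<omega>. exp (t * (X \<omega> - integral\<^sup>L M X)) \<partial>M) \<le> t\<^sup>2 * v / (2 * (1 - c * \<bar>t\<bar>)))"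

definition sub_gamma_distribution :: "real measure \<Rightarrow> bool" where
  "sub_gamma_distribution P \<longleftrightarrow> (\<exists>v\<ge>0. \<exists>c\<ge>0. sub_gamma P (\<lambda>x. x) v c)"

text \<open>The law with density proportional to \<open>exp (- \<rho>)\<close>. The base measure is the completed
  Lebesgue measure: a function \<open>\<rho>\<close> that is only differentiable almost everywhere need not be
  Borel measurable, and neither need \<open>deriv \<rho>\<close>.\<close>

definition gibbs_law :: "(real \<Rightarrow> real) \<Rightarrow> real measure" where
  "gibbs_law \<rho> = density lebesgue
     (\<lambda>y. ennreal (exp (- \<rho> y) / (\<integral>z. exp (- \<rho> z) \<partial>lebesgue)))"

definition twice_differentiable :: "(real \<Rightarrow> real) \<Rightarrow> bool" where
  "twice_differentiable h \<longleftrightarrow>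
     (\<forall>x. h field_differentiable (at x)) \<and> (\<forall>x. deriv h field_differentiable (at x))"

definition twice_cont_differentiable :: "(real \<Rightarrow> real) \<Rightarrow> bool" where
  "twice_cont_differentiable h \<longleftrightarrow>
     twice_differentiable h \<and> continuous_on UNIV (deriv (deriv h))"

definition ae_lipschitz_derivative :: "(real \<Rightarrow> real) \<Rightarrow> bool" where
  "ae_lipschitz_derivative \<rho> \<longleftrightarrow>
     (\<exists>h L. L-lipschitz_on UNIV h \<and>
        (AE x in lebesgue. (\<rho> has_real_derivative h x) (at x)))"

definition langevin :: "real measure \<Rightarrow> (real \<Rightarrow> real) \<Rightarrow> (real \<Rightarrow> real) \<Rightarrow> bool" where
  "langevin P \<rho> g \<longleftrightarrow>
     integrable lebesgue (\<lambda>x. exp (- \<rho> x)) \<and>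
     (ae_lipschitz_derivative \<rho> \<or>
      twice_cont_differentiable \<rho> \<and>
        (\<exists>b. \<forall>x. b \<le> (deriv \<rho> x)\<^sup>2 - deriv (deriv \<rho>) x / 2) \<or>
      twice_cont_differentiable \<rho> \<and>
        (\<exists>a b. \<forall>x. x * deriv \<rho> x \<ge> - a * x\<^sup>2 - b)) \<and>
     (\<exists>v>0. \<exists>c\<ge>0. sub_gamma (gibbs_law \<rho>) (deriv \<rho>) v c) \<and>
     twice_differentiable g \<and>
     (\<exists>B. \<forall>x. \<bar>deriv g x\<bar> \<le> B \<and> \<bar>deriv (deriv g) x\<bar> \<le> B) \<and>
     distr (gibbs_law \<rho>) borel g = P"


section \<open>Stability of random optimization problems\<close>

definition packing_number :: "'s set \<Rightarrow> ('s \<Rightarrow> 's \<Rightarrow> real) \<Rightarrow> real \<Rightarrow> enat" where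
  "packing_number T d \<epsilon> =
     (SUP U \<in> {U. U \<subseteq> T \<and> finite U \<and> pairwise (\<lambda>x y. d x y > \<epsilon>) U}. enat (card U))"

definition input_space :: "'k set \<Rightarrow> ('k \<Rightarrow> real) measure" where
  "input_space I = Pi\<^sub>M I (\<lambda>_. borel)"

definition input_vector :: "'k set \<Rightarrow> ('k \<Rightarrow> 'w \<Rightarrow> real) \<Rightarrow> 'w \<Rightarrow> 'k \<Rightarrow> real" where
  "input_vector I X \<omega> = (\<lambda>e\<in>I. X e \<omega>)"

definition independent_copy ::
  "'w measure \<Rightarrow> 'k set \<Rightarrow> ('k \<Rightarrow> 'w \<Rightarrow> real) \<Rightarrow> ('k \<Rightarrow> 'w \<Rightarrow> real) \<Rightarrow> bool" where
  "independent_copy M I X Y \<longleftrightarrow>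
     prob_space.indep_var M (input_space I) (input_vector I X) (input_space I) (input_vector I Y) \<and>
     distr M (input_space I) (input_vector I Y) = distr M (input_space I) (input_vector I X)"

definition perturb ::
  "'k set \<Rightarrow> ('k \<Rightarrow> 'w \<Rightarrow> real) \<Rightarrow> ('k \<Rightarrow> 'w \<Rightarrow> real) \<Rightarrow> 'k \<Rightarrow> 'w \<Rightarrow> real" where
  "perturb J X Y e = (if e \<in> J then Y e else X e)"

text \<open>All arguments but the last two describe the sequence of problems: probability spaces,
  input index sets, parameter spaces, objectives, metrics, and the perturbation blocks
  \<open>J n l\<close> for \<open>l \<in> L n\<close>. The last two are the input \<open>X\<close> and the family \<open>Y\<close> of
  independent copies that replaces it on the blocks. The optimizer is \<open>arg_min_on\<close>, which
  selects an arbitrary minimizer as a function of the input when there are several.\<close>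

definition stable_under_small_perturbations ::
  "(nat \<Rightarrow> 'w measure) \<Rightarrow> (nat \<Rightarrow> 'k set) \<Rightarrow> (nat \<Rightarrow> 's set) \<Rightarrow>
   (nat \<Rightarrow> ('k \<Rightarrow> real) \<Rightarrow> 's \<Rightarrow> real) \<Rightarrow> (nat \<Rightarrow> 's \<Rightarrow> 's \<Rightarrow> real) \<Rightarrow>
   (nat \<Rightarrow> 'l set) \<Rightarrow> (nat \<Rightarrow> 'l \<Rightarrow> 'k set) \<Rightarrow>
   (nat \<Rightarrow> 'k \<Rightarrow> 'w \<Rightarrow> real) \<Rightarrow> (nat \<Rightarrow> 'l \<Rightarrow> 'k \<Rightarrow> 'w \<Rightarrow> real) \<Rightarrow> bool" where
  "stable_under_small_perturbations M I S H d L J X Y \<longleftrightarrow>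
     (\<forall>n. finite (L n) \<and> (\<Union>l\<in>L n. J n l) = I n) \<and>
     (\<forall>\<epsilon>>0. \<forall>\<delta>>0. \<exists>K::enat. K < \<infinity> \<and>
        limsup (\<lambda>n. ereal (measure (M n) {\<omega> \<in> space (M n).
          (INF A \<in> {A. A \<subseteq> L n \<and> real (card A) > (1 - \<epsilon>) * real (card (L n))}.
             packing_number
               ((\<lambda>l. arg_min_on (H n (input_vector (I n) (perturb (J n l) (X n) (Y n l)) \<omega>)) (S n)) ` A)
               (d n) \<epsilon>) \<ge> K}))
        \<le> ereal \<delta>)"


section \<open>The Sherrington--Kirkpatrick model\<close>

definition sk_spins :: "nat \<Rightarrow> (nat \<Rightarrow> real) set" where
  "sk_spins n = {\<sigma> \<in> {1..n} \<rightarrow>\<^sub>E {1, -1}. \<sigma> 1 = 1}"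

definition sk_metric :: "nat \<Rightarrow> (nat \<Rightarrow> real) \<Rightarrow> (nat \<Rightarrow> real) \<Rightarrow> real" where
  "sk_metric n \<sigma> \<tau> = real (card {i \<in> {1..n}. \<sigma> i \<noteq> \<tau> i}) / real n"

definition sk_edges :: "nat \<Rightarrow> (nat \<times> nat) set" where
  "sk_edges n = {(i, j). 1 \<le> i \<and> i < j \<and> j \<le> n}"

definition sk_hamiltonian :: "nat \<Rightarrow> (nat \<times> nat \<Rightarrow> real) \<Rightarrow> (nat \<Rightarrow> real) \<Rightarrow> real" where
  "sk_hamiltonian n x \<sigma> = - (\<Sum>(i, j)\<in>sk_edges n. x (i, j) * \<sigma> i * \<sigma> j)"

definition sk_block :: "nat \<Rightarrow> nat \<Rightarrow> (nat \<times> nat) set" where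
  "sk_block n i = {(i, j) | j. i < j \<and> j \<le> n} \<union> {(j, i) | j. 1 \<le> j \<and> j < i}"

end

theory Submission
  imports Defs
begin

text \<open>
  Let \<open>opt\<close> be the maximum of \<open>- H\<close>; sub-Gamma tails give a mean of order \<open>n powr (3/2)\<close>.

  Near-optimality. The optimizer of the problem with row \<open>i\<close> resampled is independent of the
  old row \<open>i\<close>, and the old optimizer is independent of the new row. So the expected loss of the
  resampled optimizer in the original problem is at most twice the mean contribution of row
  \<open>i\<close> to the optimal value. Summed over \<open>i\<close> this is of order \<open>n powr (3/2)\<close>: all but few
  of the perturbed optimizers are within \<open>K * sqrt n\<close> of the optimum.

  Few separated near-optima. Refresh a random block of about \<open>n / L\<close> of the couplings. The law
  of the disorder, hence the mean of \<open>opt\<close>, does not change, and the refreshed block costs on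
  average the fraction \<open>1 / (n * L)\<close> of \<open>opt\<close>, which is of order \<open>sqrt n / L\<close>. Two
  well-separated configurations receive different noise of order \<open>sqrt (n / L)\<close>, so the better
  one of a pair gains an amount of that order. If there are \<open>2 ^ T\<close> separated near-optima,
  \<open>T\<close> rounds of a tournament between them collect a gain of order \<open>T * sqrt (n / L)\<close>,
  against \<open>K * sqrt n\<close> for near-optimality. Comparing means, the probability of this event is
  of order \<open>1 / sqrt L\<close> once \<open>T\<close> is large, and \<open>L\<close> is at our disposal.
\<close>

section \<open>Independent inputs\<close>

text \<open>The argument rests on a difference of scaling. The share of \<open>opt\<close> that sits
  on a block is proportional to the size of the block, whereas the noise that separates two
  competitors has the order of its square root. Gain and cost are both linear in \<open>T\<close>;
  once half of the gain has paid for \<open>K * sqrt n\<close>, the number of rounds cancels and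
  cost over gain is of order \<open>1 / sqrt L\<close>.

  Hamming distance alone does not separate the noise. Coefficients are products of two spins, so
  nearly antipodal configurations have nearly equal coefficients, and such pairs exist although the
  first spin is fixed. Half of a packing is given up to be rid of them; hence a packing of more than
  \<open>2 ^ Suc T\<close> points feeds a tournament of \<open>2 ^ T\<close>.

  The noise has to be bounded below in mean absolute value for an arbitrary law. Fourth moments,
  supplied by the sub-Gamma tails, give this with a constant that depends on \<open>P\<close> only.

  The joint law of the copies stays arbitrary: regrets are added over \<open>i\<close> by linearity
  of the mean, and the tournament works with auxiliary fresh variables that have nothing to do with
  the copies.\<close>

locale iid_inputs = P: prob_space P for P :: "real measure" +
  fixes E :: "'e set"
  assumes sets_P [measurable_cong]: "sets P = sets borel"
    and finite_E: "finite E"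
begin

abbreviation \<mu> :: "('e \<Rightarrow> real) measure" where
  "\<mu> \<equiv> Pi\<^sub>M E (\<lambda>_. P)"

sublocale PE: finite_product_prob_space "\<lambda>_. P" E
  by unfold_locales (fact finite_E)

sublocale pair: pair_prob_space \<mu> \<mu>
  by unfold_locales

lemma sets_mu: "sets \<mu> = sets (Pi\<^sub>M E (\<lambda>_. borel))"
  by (intro sets_PiM_cong) (simp_all add: sets_P)

lemma space_mu: "space \<mu> = E \<rightarrow>\<^sub>E UNIV"
  using sets_eq_imp_space_eq[OF sets_mu] by (simp add: space_PiM)

lemma prob_space_mu: "prob_space \<mu>"
  by (rule prob_space_PiM) (rule P.prob_space_axioms)

lemma measure_space_mu: "measure \<mu> (space \<mu>) = 1"
  by (rule prob_space.prob_space[OF prob_space_mu])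

lemma measurable_coordinate [measurable]: "(\<lambda>x. x e) \<in> borel_measurable \<mu>"
proof (cases "e \<in> E")
  case True
  then have "(\<lambda>x. x e) \<in> measurable \<mu> P" by measurable
  then show ?thesis using measurable_cong_sets[OF refl sets_P] by blast
next
  case False
  have "(\<lambda>x. x e) \<in> borel_measurable \<mu> \<longleftrightarrow> (\<lambda>x. undefined::real) \<in> borel_measurable \<mu>"
    by (rule measurable_cong) (use False in \<open>auto simp: space_mu PiE_def extensional_def\<close>)
  then show ?thesis by simp
qed

text \<open>Restricting to \<open>E\<close> puts the result into \<open>space \<mu>\<close> for all
  arguments, without side conditions on \<open>x\<close> and \<open>w\<close>.\<close>

definition resample :: "'e set \<Rightarrow> ('e \<Rightarrow> real) \<Rightarrow> ('e \<Rightarrow> real) \<Rightarrow> 'e \<Rightarrow> real" where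
  "resample B x w = (\<lambda>e\<in>E. if e \<in> B then w e else x e)"

lemma resample_apply: "e \<in> E \<Longrightarrow> resample B x w e = (if e \<in> B then w e else x e)"
  by (simp add: resample_def)

lemma resample_in_space: "resample B x w \<in> space \<mu>"
  by (auto simp: resample_def space_mu)

lemma measurable_into_mu:
  assumes "\<And>e. e \<in> E \<Longrightarrow> (\<lambda>z. g z e) \<in> borel_measurable N"
    and "\<And>z. z \<in> space N \<Longrightarrow> g z \<in> extensional E"
  shows "g \<in> measurable N \<mu>"
proof -
  have "(\<lambda>z. \<lambda>e\<in>E. g z e) \<in> measurable N \<mu>"
    by (intro measurable_restrict) (use assms(1) measurable_cong_sets[OF refl sets_P] in blast)
  moreover have "(\<lambda>e\<in>E. g z e) = g z" if "z \<in> space N" for z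
    using assms(2)[OF that] by (rule extensional_restrict)
  ultimately show ?thesis by (simp cong: measurable_cong)
qed

lemma measurable_resample:
  assumes "f \<in> measurable N \<mu>" "g \<in> measurable N \<mu>"
  shows "(\<lambda>z. resample B (f z) (g z)) \<in> measurable N \<mu>"
proof (rule measurable_into_mu)
  fix e assume e: "e \<in> E"
  have "(\<lambda>z. f z e) \<in> borel_measurable N" "(\<lambda>z. g z e) \<in> borel_measurable N"
    using measurable_compose[OF assms(1) measurable_coordinate]
      measurable_compose[OF assms(2) measurable_coordinate] by auto
  then show "(\<lambda>z. resample B (f z) (g z) e) \<in> borel_measurable N"
    using e by (cases "e \<in> B") (simp_all add: resample_apply)
qed (simp add: resample_def)

text \<open>The restrictions of \<open>x\<close> to \<open>E - B\<close> and of an independent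
  \<open>w\<close> to \<open>E \<inter> B\<close> have independent product laws, and
  \<open>merge\<close> glues them together. This invariance is what keeps the mean of
  \<open>opt\<close> fixed through every round of refreshing.\<close>

lemma distr_resample:
  "distr (\<mu> \<Otimes>\<^sub>M \<mu>) \<mu> (\<lambda>(x, w). resample B x w) = \<mu>"
proof -
  let ?I = "E - B" and ?J = "E \<inter> B"
  let ?PI = "Pi\<^sub>M ?I (\<lambda>_. P)" and ?PJ = "Pi\<^sub>M ?J (\<lambda>_. P)"
  have I: "?PI = distr \<mu> ?PI (\<lambda>x. restrict x ?I)" and J: "?PJ = distr \<mu> ?PJ (\<lambda>x. restrict x ?J)"
    by (intro PE.distr_restrict finite_E; blast)+
  have mI: "(\<lambda>x. restrict x ?I) \<in> measurable \<mu> ?PI" and mJ: "(\<lambda>x. restrict x ?J) \<in> measurable \<mu> ?PJ"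
    by (intro measurable_restrict_subset; blast)+
  interpret pJ: prob_space ?PJ by (rule prob_space_PiM) (rule P.prob_space_axioms)
  have "?PI \<Otimes>\<^sub>M ?PJ = distr (\<mu> \<Otimes>\<^sub>M \<mu>) (?PI \<Otimes>\<^sub>M ?PJ) (\<lambda>(x, w). (restrict x ?I, restrict w ?J))"
    using pair_measure_distr[OF mI mJ] I J pJ.sigma_finite_measure_axioms by simp
  moreover have "distr (?PI \<Otimes>\<^sub>M ?PJ) (Pi\<^sub>M (?I \<union> ?J) (\<lambda>_. P)) (merge ?I ?J) = Pi\<^sub>M (?I \<union> ?J) (\<lambda>_. P)"
    by (rule PE.distr_merge) (use finite_E in auto)
  moreover have "?I \<union> ?J = E" by auto
  moreover have "merge ?I ?J \<in> measurable (?PI \<Otimes>\<^sub>M ?PJ) (Pi\<^sub>M (?I \<union> ?J) (\<lambda>_. P))"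
    by (rule measurable_merge)
  moreover have "(\<lambda>(x, w). (restrict x ?I, restrict w ?J)) \<in> measurable (\<mu> \<Otimes>\<^sub>M \<mu>) (?PI \<Otimes>\<^sub>M ?PJ)"
    using mI mJ by measurable
  ultimately have "\<mu> = distr (\<mu> \<Otimes>\<^sub>M \<mu>) \<mu> (merge ?I ?J \<circ> (\<lambda>(x, w). (restrict x ?I, restrict w ?J)))"
    by (metis (no_types, lifting) distr_distr)
  also have "merge ?I ?J \<circ> (\<lambda>(x, w). (restrict x ?I, restrict w ?J)) = (\<lambda>(x, w). resample B x w)"
    by (auto simp: fun_eq_iff merge_def resample_def)
  finally show ?thesis by simp
qed

lemma indep_coordinates:
  assumes "E \<noteq> {}"
  shows "PE.indep_vars (\<lambda>_. P) (\<lambda>e x. x e) E"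
proof -
  have "distr \<mu> (Pi\<^sub>M E (\<lambda>_. P)) (\<lambda>x. \<lambda>i\<in>E. x i) = distr \<mu> \<mu> (\<lambda>x. x)"
    by (intro distr_cong) (auto simp: space_PiM extensional_restrict PiE_def)
  moreover have "Pi\<^sub>M E (\<lambda>i. distr \<mu> P (\<lambda>x. x i)) = \<mu>"
    by (intro PiM_cong refl distr_PiM_component P.prob_space_axioms)
  ultimately show ?thesis
    by (subst PE.indep_vars_iff_distr_eq_PiM'[OF assms]) simp_all
qed

text \<open>\<open>F\<close> depends on the other coordinates only, hence is independent of
  \<open>x e\<close>. This evaluates the cross terms in the moment expansion and removes those in
  the regret.\<close>

lemma
  fixes F :: "('e \<Rightarrow> real) \<Rightarrow> real"
  assumes e: "e \<in> E" and F: "integrable \<mu> F" and h: "integrable P h"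
    and const: "\<And>x t. x \<in> space \<mu> \<Longrightarrow> F (x(e := t)) = F x"
  shows integrable_coordinate_mult: "integrable \<mu> (\<lambda>x. F x * h (x e))"
    and integral_coordinate_mult: "(\<integral>x. F x * h (x e) \<partial>\<mu>) = (\<integral>x. F x \<partial>\<mu>) * (\<integral>t. h t \<partial>P)"
proof -
  let ?I = "E - {e}"
  have [measurable]: "F \<in> borel_measurable \<mu>" "h \<in> borel_measurable P"
    using F h by auto
  define Y1 where "Y1 = (\<lambda>z :: 'e \<Rightarrow> real. h (z e))"
  \<comment> \<open>Any value would do at \<open>e\<close>, since \<open>F\<close> ignores it; some
    value is needed to turn a point of the smaller product into one of
    \<open>space \<mu>\<close>.\<close>
  define Y2 where "Y2 = (\<lambda>z :: 'e \<Rightarrow> real. F (z(e := 0)))"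
  let ?X1 = "\<lambda>x. restrict x {e}" and ?X2 = "\<lambda>x. restrict x ?I"
  have ind: "PE.indep_var (Pi\<^sub>M {e} (\<lambda>_. P)) ?X1 (Pi\<^sub>M ?I (\<lambda>_. P)) ?X2"
    using PE.indep_var_restrict[OF indep_coordinates, of "{e}" ?I] e by auto
  have Y1: "Y1 \<in> borel_measurable (Pi\<^sub>M {e} (\<lambda>_. P))"
    unfolding Y1_def by (intro measurable_compose[OF measurable_component_singleton]) auto
  have "(\<lambda>z. z(e := 0)) \<in> measurable (Pi\<^sub>M ?I (\<lambda>_. P)) \<mu>"
  proof (rule measurable_into_mu)
    fix e' assume e': "e' \<in> E"
    show "(\<lambda>z. (z(e := 0)) e') \<in> borel_measurable (Pi\<^sub>M ?I (\<lambda>_. P))"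
    proof (cases "e' = e")
      case False
      then have "(\<lambda>z. z e') \<in> measurable (Pi\<^sub>M ?I (\<lambda>_. P)) P"
        using e' by (intro measurable_component_singleton) auto
      then show ?thesis using False measurable_cong_sets[OF refl sets_P] by auto
    qed simp
  qed (use e in \<open>auto simp: space_PiM PiE_def extensional_def\<close>)
  then have Y2: "Y2 \<in> borel_measurable (Pi\<^sub>M ?I (\<lambda>_. P))"
    unfolding Y2_def by measurable
  have ind': "PE.indep_var borel (Y1 \<circ> ?X1) borel (Y2 \<circ> ?X2)"
    by (rule PE.indep_var_compose[OF ind Y1 Y2])
  have eq1: "(Y1 \<circ> ?X1) x = h (x e)" for x by (simp add: Y1_def)
  have eq2: "(Y2 \<circ> ?X2) x = F x" if "x \<in> space \<mu>" for x
  proof -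
    have "(restrict x ?I)(e := 0) = x(e := 0)"
      using that e by (auto simp: fun_eq_iff space_mu PiE_def extensional_def)
    then show ?thesis using const[OF that] by (simp add: Y2_def)
  qed
  have "distr \<mu> P (\<lambda>x. x e) = P"
    by (rule distr_PiM_component) (use e P.prob_space_axioms in auto)
  moreover have me: "(\<lambda>x. x e) \<in> measurable \<mu> P" using e by measurable
  ultimately have hi: "integrable \<mu> (\<lambda>x. h (x e))" and heq: "(\<integral>x. h (x e) \<partial>\<mu>) = (\<integral>t. h t \<partial>P)"
    using h integrable_distr_eq[OF me, of h] integral_distr[OF me, of h] by auto
  have i1: "integrable \<mu> (Y1 \<circ> ?X1)" using hi by (simp add: eq1[abs_def] comp_def Y1_def)
  have i2: "integrable \<mu> (Y2 \<circ> ?X2)" using F eq2 by (simp cong: Bochner_Integration.integrable_cong)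
  have "integrable \<mu> (\<lambda>x. (Y1 \<circ> ?X1) x * (Y2 \<circ> ?X2) x)"
    by (rule PE.indep_var_integrable[OF ind' i1 i2])
  moreover have "integrable \<mu> (\<lambda>x. (Y1 \<circ> ?X1) x * (Y2 \<circ> ?X2) x) = integrable \<mu> (\<lambda>x. F x * h (x e))"
    by (intro Bochner_Integration.integrable_cong) (auto simp: eq1 eq2 simp del: comp_apply)
  ultimately show "integrable \<mu> (\<lambda>x. F x * h (x e))" by simp
  have "(\<integral>x. (Y1 \<circ> ?X1) x * (Y2 \<circ> ?X2) x \<partial>\<mu>) = (\<integral>x. (Y1 \<circ> ?X1) x \<partial>\<mu>) * (\<integral>x. (Y2 \<circ> ?X2) x \<partial>\<mu>)"
    by (rule PE.indep_var_lebesgue_integral[OF ind' i1 i2])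
  moreover have "(\<integral>x. (Y1 \<circ> ?X1) x * (Y2 \<circ> ?X2) x \<partial>\<mu>) = (\<integral>x. F x * h (x e) \<partial>\<mu>)"
    by (intro Bochner_Integration.integral_cong) (auto simp: eq2 eq1 simp del: comp_apply)
  moreover have "(\<integral>x. (Y2 \<circ> ?X2) x \<partial>\<mu>) = (\<integral>x. F x \<partial>\<mu>)"
    by (intro Bochner_Integration.integral_cong) (auto simp: eq2 simp del: comp_apply)
  ultimately show "(\<integral>x. F x * h (x e) \<partial>\<mu>) = (\<integral>x. F x \<partial>\<mu>) * (\<integral>t. h t \<partial>P)"
    using heq by (simp add: eq1 mult.commute del: comp_apply)
qed

end

section \<open>Moments of linear forms\<close>

lemma (in finite_measure) integrable_power_le_4:
  fixes f :: "'a \<Rightarrow> real"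
  assumes [measurable]: "f \<in> borel_measurable M" and f4: "integrable M (\<lambda>x. f x ^ 4)" and "k \<le> 4"
  shows "integrable M (\<lambda>x. f x ^ k)"
proof (rule Bochner_Integration.integrable_bound)
  show "integrable M (\<lambda>x. 1 + f x ^ 4)" using f4 by simp
  show "AE x in M. norm (f x ^ k) \<le> norm (1 + f x ^ 4)"
  proof (rule AE_I2)
    fix x
    have "\<bar>f x\<bar> ^ k \<le> 1 + \<bar>f x\<bar> ^ 4"
    proof (cases "\<bar>f x\<bar> \<le> 1")
      case True
      then show ?thesis using power_le_one[of "\<bar>f x\<bar>" k] by (auto intro: add_increasing2)
    next
      case False
      then show ?thesis using power_increasing[of k 4 "\<bar>f x\<bar>"] \<open>k \<le> 4\<close> by linarith
    qed
    then show "norm (f x ^ k) \<le> norm (1 + f x ^ 4)"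
      by (simp add: power_abs)
  qed
qed simp

locale centred_inputs = iid_inputs P E for P :: "real measure" and E :: "'e set" +
  assumes integrable_4: "integrable P (\<lambda>t. t ^ 4)"
    and mean_0: "(\<integral>t. t \<partial>P) = 0"
begin

definition var :: real where "var = (\<integral>t. t\<^sup>2 \<partial>P)"

definition m4 :: real where "m4 = (\<integral>t. t ^ 4 \<partial>P)"

text \<open>The constant in the L1-L2 comparison for linear forms: the level \<open>\<tau>\<close>
  chosen in \<open>l1_norm_linear_ge\<close> makes \<open>var / 2 * A / \<tau>\<close> equal to this
  number times \<open>sqrt A\<close>.\<close>

definition l1_const :: real where
  "l1_const = var / 2 * sqrt (var / (2 * (m4 + 3 * var\<^sup>2)))"

lemma integrable_power: "k \<le> 4 \<Longrightarrow> integrable P (\<lambda>t. t ^ k)"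
  by (rule P.integrable_power_le_4[OF _ integrable_4])
    (simp add: measurable_cong_sets[OF sets_P refl])

lemma integrable_id: "integrable P (\<lambda>t. t)"
  using integrable_power[of 1] by simp

lemma var_nonneg: "0 \<le> var" unfolding var_def by simp
lemma m4_nonneg: "0 \<le> m4" unfolding m4_def by simp

lemma l1_const_nonneg: "0 \<le> l1_const"
  unfolding l1_const_def using var_nonneg m4_nonneg by (intro mult_nonneg_nonneg) auto

text \<open>Induction adds one independent centred term. In the fourth power the products of a first
  and a third power have mean 0, so only the pure fourth powers and the middle term remain. In the
  constant, \<open>m4\<close> absorbs the new fourth power and \<open>3 * var\<^sup>2\<close> pays
  for the middle term.\<close>

lemma moments_linear:
  assumes "D \<subseteq> E"
  shows "integrable \<mu> (\<lambda>x. (\<Sum>e\<in>D. c e * x e) ^ 4) \<and>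
    (\<integral>x. (\<Sum>e\<in>D. c e * x e) \<partial>\<mu>) = 0 \<and>
    (\<integral>x. (\<Sum>e\<in>D. c e * x e)\<^sup>2 \<partial>\<mu>) = var * (\<Sum>e\<in>D. (c e)\<^sup>2) \<and>
    (\<integral>x. (\<Sum>e\<in>D. c e * x e) ^ 4 \<partial>\<mu>) \<le> (m4 + 3 * var\<^sup>2) * (\<Sum>e\<in>D. (c e)\<^sup>2)\<^sup>2"
  using finite_subset[OF assms finite_E] assms
proof (induction D rule: finite_induct)
  case empty
  then show ?case by simp
next
  case (insert e D)
  define S where "S = (\<lambda>x::'e \<Rightarrow> real. \<Sum>e\<in>D. c e * x e)"
  define A where "A = (\<Sum>e\<in>D. (c e)\<^sup>2)"
  have e: "e \<in> E" "e \<notin> D" "D \<subseteq> E" using insert by auto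
  have IH: "integrable \<mu> (\<lambda>x. S x ^ 4)" "(\<integral>x. S x \<partial>\<mu>) = 0" "(\<integral>x. (S x)\<^sup>2 \<partial>\<mu>) = var * A"
     "(\<integral>x. S x ^ 4 \<partial>\<mu>) \<le> (m4 + 3 * var\<^sup>2) * A\<^sup>2"
    using insert.IH e unfolding S_def A_def by auto
  have Sm[measurable]: "S \<in> borel_measurable \<mu>" unfolding S_def by measurable
  have Sk: "integrable \<mu> (\<lambda>x. S x ^ k)" if "k \<le> 4" for k
    by (rule PE.integrable_power_le_4[OF Sm IH(1) that])
  have Sc: "S (x(e := t)) = S x" for x t
    unfolding S_def using e by (intro sum.cong) auto
  have ip: "integrable \<mu> (\<lambda>x. S x ^ j * (x e) ^ k)"
    and eq: "(\<integral>x. S x ^ j * (x e) ^ k \<partial>\<mu>) = (\<integral>x. S x ^ j \<partial>\<mu>) * (\<integral>t. t ^ k \<partial>P)"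
    if "j \<le> 4" "k \<le> 4" for j k
    using integrable_coordinate_mult[OF e(1) Sk[OF that(1)] integrable_power[OF that(2)]]
      integral_coordinate_mult[OF e(1) Sk[OF that(1)] integrable_power[OF that(2)]] Sc by auto
  have sum: "(\<Sum>e\<in>insert e D. c e * x e) = S x + c e * x e" for x
    using insert by (simp add: S_def)
  have sumA: "(\<Sum>e\<in>insert e D. (c e)\<^sup>2) = A + (c e)\<^sup>2"
    using insert by (simp add: A_def)
  \<comment> \<open>The trivial powers 0 and 1 are kept so that every summand has the shape of
    \<open>ip\<close> and \<open>eq\<close>.\<close>
  have exp4: "(S x + c e * x e) ^ 4 = S x ^ 4 * x e ^ 0 + 4 * c e * (S x ^ 3 * x e ^ 1)
     + 6 * (c e)\<^sup>2 * (S x ^ 2 * x e ^ 2) + 4 * c e ^ 3 * (S x ^ 1 * x e ^ 3) + c e ^ 4 * (S x ^ 0 * x e ^ 4)" for x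
    by (simp add: algebra_simps power4_eq_xxxx power3_eq_cube power2_eq_square)
  have exp2: "(S x + c e * x e)\<^sup>2 = (S x)\<^sup>2 + 2 * c e * (S x * x e) + (c e)\<^sup>2 * (x e)\<^sup>2" for x
    by (simp add: algebra_simps power2_eq_square)
  have exp1: "S x + c e * x e = S x ^ 1 * x e ^ 0 + c e * (S x ^ 0 * x e ^ 1)" for x
    by simp
  note [simp] = mean_0 var_def[symmetric] m4_def[symmetric] IH(2,3) measure_space_mu P.prob_space
  have 1: "integrable \<mu> (\<lambda>x. (S x + c e * x e) ^ 4)"
    unfolding exp4 by (intro Bochner_Integration.integrable_add integrable_mult_right ip) simp_all
  have 2: "(\<integral>x. (S x + c e * x e) \<partial>\<mu>) = 0"
    by (subst exp1, subst Bochner_Integration.integral_add, (intro integrable_mult_right ip; simp)+,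
        subst integral_mult_right_zero, (subst eq, simp, simp)+) simp
  have 3: "(\<integral>x. (S x + c e * x e)\<^sup>2 \<partial>\<mu>) = var * (A + (c e)\<^sup>2)"
    unfolding exp2 using ip[of 1 1] eq[of 1 1] ip[of 0 2] eq[of 0 2] Sk[of 2] measure_space_mu
    by (simp add: distrib_left)
  have 4: "(\<integral>x. (S x + c e * x e) ^ 4 \<partial>\<mu>) = (\<integral>x. S x ^ 4 \<partial>\<mu>) + 6 * (c e)\<^sup>2 * (var * A * var) + c e ^ 4 * m4"
    unfolding exp4 using ip[of 3 1] eq[of 3 1] ip[of 2 2] eq[of 2 2] ip[of 1 3] eq[of 1 3]
      ip[of 0 4] eq[of 0 4] IH(1) measure_space_mu
    by simp
  also have "\<dots> \<le> (m4 + 3 * var\<^sup>2) * A\<^sup>2 + 6 * (c e)\<^sup>2 * (var * A * var) + c e ^ 4 * m4"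
    using IH(4) by simp
  also have "\<dots> \<le> (m4 + 3 * var\<^sup>2) * (A + (c e)\<^sup>2)\<^sup>2"
  proof -
    have "0 \<le> A" unfolding A_def by (simp add: sum_nonneg)
    then have "0 \<le> 2 * m4 * A * (c e)\<^sup>2 + 3 * var\<^sup>2 * ((c e)\<^sup>2)\<^sup>2"
      using m4_nonneg by (intro add_nonneg_nonneg mult_nonneg_nonneg) auto
    moreover have "(m4 + 3 * var\<^sup>2) * (A + (c e)\<^sup>2)\<^sup>2 - ((m4 + 3 * var\<^sup>2) * A\<^sup>2 + 6 * (c e)\<^sup>2 * (var * A * var) + c e ^ 4 * m4)
       = 2 * m4 * A * (c e)\<^sup>2 + 3 * var\<^sup>2 * ((c e)\<^sup>2)\<^sup>2"
      by algebra
    ultimately show ?thesis by linarith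
  qed
  finally show ?case unfolding sum sumA using 1 2 3 by auto
qed

lemma integrable_linear: "D \<subseteq> E \<Longrightarrow> integrable \<mu> (\<lambda>x. \<Sum>e\<in>D. c e * x e)"
  using PE.integrable_power_le_4[of "\<lambda>x. \<Sum>e\<in>D. c e * x e" 1] moments_linear[of D c] by simp

lemma integral_linear: "D \<subseteq> E \<Longrightarrow> (\<integral>x. (\<Sum>e\<in>D. c e * x e) \<partial>\<mu>) = 0"
  using moments_linear by blast

text \<open>A fourth moment comparable to the squared second moment keeps the second moment from
  living on rare large values. Formally, \<open>s\<^sup>2 / \<tau> - s ^ 4 / \<tau> ^ 3\<close> is a
  minorant of the absolute value of \<open>s\<close>, and it is integrated.\<close>

lemma l1_norm_linear_ge:
  assumes D: "D \<subseteq> E" and v: "0 < var"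
  shows "l1_const * sqrt (\<Sum>e\<in>D. (c e)\<^sup>2) \<le> (\<integral>x. \<bar>\<Sum>e\<in>D. c e * x e\<bar> \<partial>\<mu>)"
proof -
  define S where "S = (\<lambda>x::'e \<Rightarrow> real. \<Sum>e\<in>D. c e * x e)"
  define A where "A = (\<Sum>e\<in>D. (c e)\<^sup>2)"
  define C where "C = m4 + 3 * var\<^sup>2"
  have "0 < C" unfolding C_def using v m4_nonneg by (intro add_nonneg_pos) auto
  have mom: "integrable \<mu> (\<lambda>x. S x ^ 4)" "(\<integral>x. (S x)\<^sup>2 \<partial>\<mu>) = var * A" "(\<integral>x. S x ^ 4 \<partial>\<mu>) \<le> C * A\<^sup>2"
    using moments_linear[OF D, of c] by (auto simp: S_def A_def C_def)
  have Sm[measurable]: "S \<in> borel_measurable \<mu>" unfolding S_def by measurable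
  have S2: "integrable \<mu> (\<lambda>x. (S x)\<^sup>2)" using PE.integrable_power_le_4[OF Sm mom(1), of 2] by simp
  have S1: "integrable \<mu> (\<lambda>x. \<bar>S x\<bar>)" using PE.integrable_power_le_4[OF Sm mom(1), of 1] by simp
  have "l1_const * sqrt A \<le> (\<integral>x. \<bar>S x\<bar> \<partial>\<mu>)"
  proof (cases "A = 0")
    case True
    then show ?thesis by simp
  next
    case False
    then have "0 < A" unfolding A_def by (simp add: sum_nonneg order_less_le)
    \<comment> \<open>At this level the bound on the fourth-moment term is exactly half of the
      second-moment term.\<close>
    define \<tau> where "\<tau> = sqrt (2 * C * A / var)"
    have "0 < \<tau>" unfolding \<tau>_def using \<open>0 < A\<close> \<open>0 < C\<close> v by simp
    have \<tau>2: "\<tau>\<^sup>2 = 2 * C * A / var" unfolding \<tau>_def using \<open>0 < A\<close> \<open>0 < C\<close> v by simp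
    have pt: "s\<^sup>2 / \<tau> - s ^ 4 / \<tau> ^ 3 \<le> \<bar>s\<bar>" for s
    proof -
      define y where "y = \<bar>s\<bar> / \<tau>"
      have "0 \<le> y" unfolding y_def using \<open>0 < \<tau>\<close> by simp
      have "y\<^sup>2 - y ^ 4 \<le> y"
      proof (cases "y \<le> 1")
        case True
        then have "y\<^sup>2 \<le> y" using \<open>0 \<le> y\<close> by (simp add: power2_eq_square mult_left_le)
        then show ?thesis using \<open>0 \<le> y\<close> by (simp add: add_increasing2 diff_le_eq)
      next
        case False
        then have "y\<^sup>2 \<le> y ^ 4" by (intro power_increasing) auto
        then show ?thesis using \<open>0 \<le> y\<close> by linarith
      qed
      then have "\<tau> * (y\<^sup>2 - y ^ 4) \<le> \<tau> * y" using \<open>0 < \<tau>\<close> by simp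
      moreover have "\<tau> * y = \<bar>s\<bar>" "\<tau> * (y\<^sup>2 - y ^ 4) = s\<^sup>2 / \<tau> - s ^ 4 / \<tau> ^ 3"
        unfolding y_def using \<open>0 < \<tau>\<close>
        by (simp_all add: field_simps power_divide eval_nat_numeral)
      ultimately show ?thesis by simp
    qed
    have "l1_const * sqrt A = var / 2 * A / \<tau>"
    proof -
      have "sqrt (var / (2 * C)) * \<tau> = sqrt A"
        unfolding \<tau>_def using \<open>0 < A\<close> \<open>0 < C\<close> v by (simp flip: real_sqrt_mult)
      then have "sqrt (var / (2 * C)) * sqrt A * \<tau> = A"
        using \<open>0 < A\<close> by (metis (no_types) less_eq_real_def mult.assoc mult.commute real_sqrt_mult_self abs_of_pos)
      then have "sqrt (var / (2 * C)) * sqrt A = A / \<tau>" using \<open>0 < \<tau>\<close> by (simp add: field_simps)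
      then show ?thesis by (simp add: l1_const_def C_def[symmetric] mult.assoc)
    qed
    also have "\<dots> = var * A / \<tau> - C * A\<^sup>2 / \<tau> ^ 3"
    proof -
      have "C * A\<^sup>2 / \<tau> ^ 3 = C * A\<^sup>2 / \<tau>\<^sup>2 / \<tau>" by (simp add: eval_nat_numeral)
      also have "\<dots> = var / 2 * A / \<tau>"
        unfolding \<tau>2 using \<open>0 < A\<close> \<open>0 < C\<close> v by (simp add: power2_eq_square)
      finally show ?thesis using \<open>0 < \<tau>\<close> by (simp add: field_simps)
    qed
    also have "\<dots> \<le> var * A / \<tau> - (\<integral>x. S x ^ 4 \<partial>\<mu>) / \<tau> ^ 3"
      using mom(3) \<open>0 < \<tau>\<close> by (simp add: divide_right_mono)
    also have "\<dots> = (\<integral>x. (S x)\<^sup>2 / \<tau> - S x ^ 4 / \<tau> ^ 3 \<partial>\<mu>)"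
      using mom S2 by simp
    also have "\<dots> \<le> (\<integral>x. \<bar>S x\<bar> \<partial>\<mu>)"
      by (intro integral_mono S1 Bochner_Integration.integrable_diff integrable_divide S2 mom(1) pt)
    finally show ?thesis .
  qed
  then show ?thesis by (simp add: S_def A_def)
qed

end

section \<open>Block resampling on functions of linear growth\<close>

context iid_inputs
begin

text \<open>This class contains \<open>opt\<close> and is closed under maxima, linear combinations
  and refreshing. Linear growth makes \<open>F (resample B x w)\<close> integrable in
  \<open>w\<close> for every point \<open>x\<close>, not just almost every one, so the tournament
  can be argued pointwise.\<close>

definition lin_bounded :: "(('e \<Rightarrow> real) \<Rightarrow> real) \<Rightarrow> bool" where
  "lin_bounded F \<longleftrightarrow> F \<in> borel_measurable \<mu> \<and>
     (\<exists>b\<ge>0. \<forall>x\<in>space \<mu>. \<bar>F x\<bar> \<le> b * (1 + (\<Sum>e\<in>E. \<bar>x e\<bar>)))"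

lemma lin_boundedI:
  assumes "F \<in> borel_measurable \<mu>" "0 \<le> b" "\<And>x. x \<in> space \<mu> \<Longrightarrow> \<bar>F x\<bar> \<le> b * (1 + (\<Sum>e\<in>E. \<bar>x e\<bar>))"
  shows "lin_bounded F"
  using assms unfolding lin_bounded_def by blast

lemma measurable_lin_bounded: "lin_bounded F \<Longrightarrow> F \<in> borel_measurable \<mu>"
  by (simp add: lin_bounded_def)

lemma lin_bounded_mono:
  assumes F: "lin_bounded F" and "G \<in> borel_measurable \<mu>" and "0 \<le> k"
    and le: "\<And>x. x \<in> space \<mu> \<Longrightarrow> \<bar>G x\<bar> \<le> k * \<bar>F x\<bar>"
  shows "lin_bounded G"
proof -
  obtain b where b: "F \<in> borel_measurable \<mu>" "0 \<le> b" "\<And>x. x \<in> space \<mu> \<Longrightarrow> \<bar>F x\<bar> \<le> b * (1 + (\<Sum>e\<in>E. \<bar>x e\<bar>))"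
    using F unfolding lin_bounded_def by blast
  have "\<bar>G x\<bar> \<le> (k * b) * (1 + (\<Sum>e\<in>E. \<bar>x e\<bar>))" if "x \<in> space \<mu>" for x
    using le[OF that] mult_left_mono[OF b(3)[OF that] \<open>0 \<le> k\<close>] by (simp add: mult.assoc)
  then show ?thesis using assms b by (intro lin_boundedI[of G "k * b"]) auto
qed

lemma lin_bounded_const: "lin_bounded (\<lambda>_. c)"
proof (rule lin_boundedI)
  show "(\<lambda>_. c) \<in> borel_measurable \<mu>" by (rule borel_measurable_const)
  show "0 \<le> \<bar>c\<bar>" by (rule abs_ge_zero)
  fix x :: "'e \<Rightarrow> real"
  have "0 \<le> (\<Sum>e\<in>E. \<bar>x e\<bar>)" by (intro sum_nonneg abs_ge_zero)
  then have "0 \<le> \<bar>c\<bar> * (\<Sum>e\<in>E. \<bar>x e\<bar>)" by (intro mult_nonneg_nonneg abs_ge_zero)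
  then show "\<bar>c\<bar> \<le> \<bar>c\<bar> * (1 + (\<Sum>e\<in>E. \<bar>x e\<bar>))"
    unfolding distrib_left by linarith
qed

lemma lin_bounded_add:
  assumes "lin_bounded F" "lin_bounded G"
  shows "lin_bounded (\<lambda>x. F x + G x)"
proof -
  obtain b where b: "F \<in> borel_measurable \<mu>" "0 \<le> b" "\<And>x. x \<in> space \<mu> \<Longrightarrow> \<bar>F x\<bar> \<le> b * (1 + (\<Sum>e\<in>E. \<bar>x e\<bar>))"
    using assms(1) unfolding lin_bounded_def by blast
  obtain b' where b': "G \<in> borel_measurable \<mu>" "0 \<le> b'" "\<And>x. x \<in> space \<mu> \<Longrightarrow> \<bar>G x\<bar> \<le> b' * (1 + (\<Sum>e\<in>E. \<bar>x e\<bar>))"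
    using assms(2) unfolding lin_bounded_def by blast
  have "\<bar>F x + G x\<bar> \<le> (b + b') * (1 + (\<Sum>e\<in>E. \<bar>x e\<bar>))" if "x \<in> space \<mu>" for x
    using b(3)[OF that] b'(3)[OF that] abs_triangle_ineq[of "F x" "G x"]
    by (simp add: distrib_right)
  then show ?thesis using assms b b'
    by (intro lin_boundedI[of _ "b + b'"]) (auto intro: borel_measurable_add measurable_lin_bounded)
qed

lemma lin_bounded_cmult: "lin_bounded F \<Longrightarrow> lin_bounded (\<lambda>x. c * F x)"
  by (rule lin_bounded_mono[of F _ "\<bar>c\<bar>"]) (auto simp: abs_mult dest: measurable_lin_bounded)

lemma lin_bounded_divide: "lin_bounded F \<Longrightarrow> lin_bounded (\<lambda>x. F x / c)"
  using lin_bounded_cmult[of F "1 / c"] by simp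

lemma lin_bounded_abs: "lin_bounded F \<Longrightarrow> lin_bounded (\<lambda>x. \<bar>F x\<bar>)"
  by (rule lin_bounded_mono[of F _ 1]) (auto dest: measurable_lin_bounded)

lemma lin_bounded_sum: "(\<And>i. i \<in> I \<Longrightarrow> lin_bounded (F i)) \<Longrightarrow> lin_bounded (\<lambda>x. \<Sum>i\<in>I. F i x)"
  by (induction I rule: infinite_finite_induct) (auto intro: lin_bounded_const lin_bounded_add)

lemma lin_bounded_max:
  assumes "lin_bounded F" "lin_bounded G"
  shows "lin_bounded (\<lambda>x. max (F x) (G x))"
proof (rule lin_bounded_mono[of "\<lambda>x. \<bar>F x\<bar> + \<bar>G x\<bar>" _ 1])
  show "lin_bounded (\<lambda>x. \<bar>F x\<bar> + \<bar>G x\<bar>)"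
    using assms by (intro lin_bounded_add lin_bounded_abs)
  show "(\<lambda>x. max (F x) (G x)) \<in> borel_measurable \<mu>"
    by (intro borel_measurable_max measurable_lin_bounded assms)
qed auto

lemma lin_bounded_Max:
  assumes "finite I" "I \<noteq> {}" "\<And>i. i \<in> I \<Longrightarrow> lin_bounded (F i)"
  shows "lin_bounded (\<lambda>x. Max ((\<lambda>i. F i x) ` I))"
  using assms by (induction I rule: finite_ne_induct) (auto intro!: lin_bounded_max)

lemma lin_bounded_coordinate:
  assumes "e \<in> E"
  shows "lin_bounded (\<lambda>x. x e)"
proof (rule lin_boundedI[of _ 1])
  show "\<bar>x e\<bar> \<le> 1 * (1 + (\<Sum>e\<in>E. \<bar>x e\<bar>))" for x :: "'e \<Rightarrow> real"
    using member_le_sum[OF assms, of "\<lambda>e. \<bar>x e\<bar>"] finite_E by simp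
qed auto

lemma lin_bounded_linear: "D \<subseteq> E \<Longrightarrow> lin_bounded (\<lambda>x. \<Sum>e\<in>D. c e * x e)"
  by (intro lin_bounded_sum lin_bounded_cmult lin_bounded_coordinate) auto

lemma resample_bound:
  assumes "\<And>x. x \<in> space \<mu> \<Longrightarrow> \<bar>F x\<bar> \<le> b * (1 + (\<Sum>e\<in>E. \<bar>x e\<bar>))" "0 \<le> b"
  shows "\<bar>F (resample B x w)\<bar> \<le> b * (1 + (\<Sum>e\<in>E. \<bar>x e\<bar>) + (\<Sum>e\<in>E. \<bar>w e\<bar>))"
proof -
  have "(\<Sum>e\<in>E. \<bar>resample B x w e\<bar>) \<le> (\<Sum>e\<in>E. \<bar>x e\<bar> + \<bar>w e\<bar>)"
    by (intro sum_mono) (auto simp: resample_apply)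
  then have "b * (1 + (\<Sum>e\<in>E. \<bar>resample B x w e\<bar>)) \<le> b * (1 + (\<Sum>e\<in>E. \<bar>x e\<bar>) + (\<Sum>e\<in>E. \<bar>w e\<bar>))"
    using assms(2) by (intro mult_left_mono) (auto simp: sum.distrib)
  then show ?thesis using assms(1)[OF resample_in_space, of B x w] by linarith
qed

lemma measurable_resample_right: "x \<in> space \<mu> \<Longrightarrow> (\<lambda>w. resample B x w) \<in> measurable \<mu> \<mu>"
  by (intro measurable_resample) auto

lemma measurable_resample_pair: "(\<lambda>(x, w). resample B x w) \<in> measurable (\<mu> \<Otimes>\<^sub>M \<mu>) \<mu>"
  unfolding split_beta by (intro measurable_resample) auto

end

context centred_inputs
begin

lemma integrable_coordinate: "e \<in> E \<Longrightarrow> integrable \<mu> (\<lambda>x. x e)"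
  using integrable_linear[of "{e}" "\<lambda>_. 1"] by simp

lemma integrable_lin_bounded:
  assumes "lin_bounded F"
  shows "integrable \<mu> F"
proof -
  obtain b where b: "F \<in> borel_measurable \<mu>" "0 \<le> b" "\<And>x. x \<in> space \<mu> \<Longrightarrow> \<bar>F x\<bar> \<le> b * (1 + (\<Sum>e\<in>E. \<bar>x e\<bar>))"
    using assms unfolding lin_bounded_def by blast
  show ?thesis
  proof (rule Bochner_Integration.integrable_bound)
    show "integrable \<mu> (\<lambda>x. b * (1 + (\<Sum>e\<in>E. \<bar>x e\<bar>)))"
      using integrable_coordinate by auto
    show "AE x in \<mu>. norm (F x) \<le> norm (b * (1 + (\<Sum>e\<in>E. \<bar>x e\<bar>)))"
      using b by (intro AE_I2) (auto intro: order_trans[OF _ abs_ge_self])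
  qed (fact b)
qed

lemma integrable_resample:
  assumes F: "lin_bounded F" and x: "x \<in> space \<mu>"
  shows "integrable \<mu> (\<lambda>w. F (resample B x w))"
proof -
  obtain b where b: "F \<in> borel_measurable \<mu>" "0 \<le> b" "\<And>x. x \<in> space \<mu> \<Longrightarrow> \<bar>F x\<bar> \<le> b * (1 + (\<Sum>e\<in>E. \<bar>x e\<bar>))"
    using F unfolding lin_bounded_def by blast
  show ?thesis
  proof (rule Bochner_Integration.integrable_bound)
    show "integrable \<mu> (\<lambda>w. b * (1 + (\<Sum>e\<in>E. \<bar>x e\<bar>) + (\<Sum>e\<in>E. \<bar>w e\<bar>)))"
      using integrable_coordinate by auto
    show "AE w in \<mu>. norm (F (resample B x w)) \<le> norm (b * (1 + (\<Sum>e\<in>E. \<bar>x e\<bar>) + (\<Sum>e\<in>E. \<bar>w e\<bar>)))"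
      using resample_bound[of F b B x, OF b(3,2)] by (intro AE_I2) (auto intro: order_trans[OF _ abs_ge_self])
  qed (rule measurable_compose[OF measurable_resample_right[OF x] b(1)])
qed

lemma
  assumes F: "lin_bounded F"
  shows integrable_pair_resample: "integrable (\<mu> \<Otimes>\<^sub>M \<mu>) (\<lambda>(x, w). F (resample B x w))"
    and integral_pair_resample: "(\<integral>x. \<integral>w. F (resample B x w) \<partial>\<mu> \<partial>\<mu>) = (\<integral>x. F x \<partial>\<mu>)"
proof -
  have F': "integrable (distr (\<mu> \<Otimes>\<^sub>M \<mu>) \<mu> (\<lambda>(x, w). resample B x w)) F"
    unfolding distr_resample by (rule integrable_lin_bounded[OF F])
  show i: "integrable (\<mu> \<Otimes>\<^sub>M \<mu>) (\<lambda>(x, w). F (resample B x w))"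
    using integrable_distr[OF measurable_resample_pair F'] by (simp add: split_beta')
  have "(\<integral>x. F x \<partial>\<mu>) = (\<integral>x. F x \<partial>distr (\<mu> \<Otimes>\<^sub>M \<mu>) \<mu> (\<lambda>(x, w). resample B x w))"
    unfolding distr_resample ..
  also have "\<dots> = (\<integral>z. F (case z of (x, w) \<Rightarrow> resample B x w) \<partial>(\<mu> \<Otimes>\<^sub>M \<mu>))"
    by (rule integral_distr[OF measurable_resample_pair measurable_lin_bounded[OF F]])
  also have "\<dots> = (\<integral>x. \<integral>w. F (resample B x w) \<partial>\<mu> \<partial>\<mu>)"
    using pair.integral_fst'[OF i] by (simp add: split_beta')
  finally show "(\<integral>x. \<integral>w. F (resample B x w) \<partial>\<mu> \<partial>\<mu>) = (\<integral>x. F x \<partial>\<mu>)" by simp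
qed

lemma lin_bounded_integral_resample:
  assumes F: "lin_bounded F"
  shows "lin_bounded (\<lambda>x. \<integral>w. F (resample B x w) \<partial>\<mu>)"
proof -
  obtain b where b: "F \<in> borel_measurable \<mu>" "0 \<le> b" "\<And>x. x \<in> space \<mu> \<Longrightarrow> \<bar>F x\<bar> \<le> b * (1 + (\<Sum>e\<in>E. \<bar>x e\<bar>))"
    using F unfolding lin_bounded_def by blast
  define q where "q = (\<integral>w. (\<Sum>e\<in>E. \<bar>w e\<bar>) \<partial>\<mu>)"
  have q: "0 \<le> q" unfolding q_def by (simp add: sum_nonneg)
  have iw: "integrable \<mu> (\<lambda>w. \<Sum>e\<in>E. \<bar>w e\<bar>)" using integrable_coordinate by auto
  show ?thesis
  proof (rule lin_boundedI[of _ "b * (1 + q)"])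
    show "(\<lambda>x. \<integral>w. F (resample B x w) \<partial>\<mu>) \<in> borel_measurable \<mu>"
      using borel_measurable_integrable[OF integrable_pair_resample[OF F, of B]]
      by (rule PE.borel_measurable_lebesgue_integral)
    show "0 \<le> b * (1 + q)" using b q by simp
    fix x assume x: "x \<in> space \<mu>"
    have "\<bar>\<integral>w. F (resample B x w) \<partial>\<mu>\<bar> \<le> (\<integral>w. \<bar>F (resample B x w)\<bar> \<partial>\<mu>)"
      by (rule integral_abs_bound)
    also have "\<dots> \<le> (\<integral>w. b * (1 + (\<Sum>e\<in>E. \<bar>x e\<bar>) + (\<Sum>e\<in>E. \<bar>w e\<bar>)) \<partial>\<mu>)"
      using iw by (intro integral_mono resample_bound b integrable_abs integrable_resample F x) auto
    also have "\<dots> = b * (1 + (\<Sum>e\<in>E. \<bar>x e\<bar>) + q)"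
      using iw measure_space_mu by (simp add: q_def)
    also have "\<dots> \<le> b * ((1 + q) * (1 + (\<Sum>e\<in>E. \<bar>x e\<bar>)))"
    proof (rule mult_left_mono[OF _ b(2)])
      have "0 \<le> q * (\<Sum>e\<in>E. \<bar>x e\<bar>)" using q by (intro mult_nonneg_nonneg sum_nonneg) auto
      then show "1 + (\<Sum>e\<in>E. \<bar>x e\<bar>) + q \<le> (1 + q) * (1 + (\<Sum>e\<in>E. \<bar>x e\<bar>))"
        unfolding distrib_left distrib_right by linarith
    qed
    finally show "\<bar>\<integral>w. F (resample B x w) \<partial>\<mu>\<bar> \<le> b * (1 + q) * (1 + (\<Sum>e\<in>E. \<bar>x e\<bar>))"
      by (simp add: mult.assoc)
  qed
qed

end

locale block_resampling = centred_inputs P E for P :: "real measure" and E :: "'e set" +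
  fixes C :: "'c set" and blk :: "'e \<Rightarrow> 'c"
  assumes finite_C: "finite C" and C_nonempty: "C \<noteq> {}" and blk: "blk ` E \<subseteq> C"
begin

definition block :: "'c \<Rightarrow> 'e set" where
  "block c = {e \<in> E. blk e = c}"

text \<open>The Markov operator of one round: a uniformly chosen block receives fresh values. Its
  powers are conditional means given the starting point, so several rounds need no probability space
  of their own.\<close>

definition refresh :: "(('e \<Rightarrow> real) \<Rightarrow> real) \<Rightarrow> ('e \<Rightarrow> real) \<Rightarrow> real" where
  "refresh F x = (\<Sum>c\<in>C. \<integral>w. F (resample (block c) x w) \<partial>\<mu>) / card C"

lemma card_C_pos: "0 < real (card C)"
  using finite_C C_nonempty by (simp add: card_gt_0_iff)

lemma block_subset: "block c \<subseteq> E"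
  by (auto simp: block_def)

lemma sum_blocks: "(\<Sum>c\<in>C. \<Sum>e\<in>block c. h e) = (\<Sum>e\<in>E. h e)"
  unfolding block_def by (rule sum.group[OF finite_E finite_C blk])

lemma lin_bounded_refresh: "lin_bounded F \<Longrightarrow> lin_bounded (refresh F)"
  unfolding refresh_def[abs_def]
  by (intro lin_bounded_divide lin_bounded_sum lin_bounded_integral_resample)

lemma lin_bounded_refresh_funpow: "lin_bounded F \<Longrightarrow> lin_bounded ((refresh ^^ k) F)"
  by (induction k) (auto intro: lin_bounded_refresh)

lemma integral_refresh:
  assumes "lin_bounded F"
  shows "(\<integral>x. refresh F x \<partial>\<mu>) = (\<integral>x. F x \<partial>\<mu>)"
proof -
  have "(\<integral>x. refresh F x \<partial>\<mu>) = (\<Sum>c\<in>C. \<integral>x. \<integral>w. F (resample (block c) x w) \<partial>\<mu> \<partial>\<mu>) / card C"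
    unfolding refresh_def
    using integrable_lin_bounded[OF lin_bounded_integral_resample[OF assms]] by simp
  then show ?thesis using card_C_pos by (simp add: integral_pair_resample[OF assms])
qed

lemma integral_refresh_funpow:
  "lin_bounded F \<Longrightarrow> (\<integral>x. (refresh ^^ k) F x \<partial>\<mu>) = (\<integral>x. F x \<partial>\<mu>)"
  by (induction k) (auto simp: integral_refresh lin_bounded_refresh_funpow)

lemma refresh_mono:
  assumes "lin_bounded F" "lin_bounded G" "\<And>x. x \<in> space \<mu> \<Longrightarrow> F x \<le> G x" "x \<in> space \<mu>"
  shows "refresh F x \<le> refresh G x"
  unfolding refresh_def
  by (intro divide_right_mono sum_mono integral_mono integrable_resample assms resample_in_space) simp

lemma refresh_const: "refresh (\<lambda>_. k) x = k"
  using card_C_pos measure_space_mu by (simp add: refresh_def)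

lemma refresh_cmult: "refresh (\<lambda>y. k * F y) x = k * refresh F x"
  by (simp add: refresh_def sum_distrib_left)

lemma refresh_add:
  "lin_bounded F \<Longrightarrow> lin_bounded G \<Longrightarrow> x \<in> space \<mu> \<Longrightarrow> refresh (\<lambda>y. F y + G y) x = refresh F x + refresh G x"
  by (simp add: refresh_def integrable_resample sum.distrib add_divide_distrib)

lemma refresh_sum:
  assumes "\<And>i. i \<in> I \<Longrightarrow> lin_bounded (F i)" "x \<in> space \<mu>"
  shows "refresh (\<lambda>y. \<Sum>i\<in>I. F i y) x = (\<Sum>i\<in>I. refresh (F i) x)"
  using assms
  by (induction I rule: infinite_finite_induct)
    (auto simp: refresh_const refresh_add lin_bounded_sum)

end

section \<open>Tournaments driven by block resampling\<close>

text \<open>Centring bounds the right side below by the absolute value of \<open>u\<close>, and the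
  triangle inequality does the rest at the price of a factor 2. The shift will be the current
  difference of two competitors, about which nothing is known, so the bound must be uniform in
  \<open>u\<close>.\<close>

lemma (in prob_space) expectation_abs_shift_ge:
  fixes U :: "'a \<Rightarrow> real"
  assumes U: "integrable M U" and "expectation U = 0"
  shows "expectation (\<lambda>x. \<bar>U x\<bar>) / 2 \<le> expectation (\<lambda>x. \<bar>u + U x\<bar>)"
proof -
  have int: "integrable M (\<lambda>x. \<bar>u + U x\<bar>)" using U by auto
  have "\<bar>u\<bar> = \<bar>expectation (\<lambda>x. u + U x)\<bar>" using assms prob_space by simp
  also have "\<dots> \<le> expectation (\<lambda>x. \<bar>u + U x\<bar>)" by (rule integral_abs_bound)
  finally have "\<bar>u\<bar> \<le> expectation (\<lambda>x. \<bar>u + U x\<bar>)" .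
  moreover have "expectation (\<lambda>x. \<bar>U x\<bar>) \<le> expectation (\<lambda>x. \<bar>u + U x\<bar> + \<bar>u\<bar>)"
    using U int by (intro integral_mono) auto
  moreover have "expectation (\<lambda>x. \<bar>u + U x\<bar> + \<bar>u\<bar>) = expectation (\<lambda>x. \<bar>u + U x\<bar>) + \<bar>u\<bar>"
    using int prob_space by simp
  ultimately show ?thesis by simp
qed

text \<open>A maximum is the midpoint plus half the absolute difference; centred noise leaves the
  mean of the midpoint alone.\<close>

lemma (in prob_space) expectation_max_shift_ge:
  fixes U V :: "'a \<Rightarrow> real"
  assumes U: "integrable M U" "expectation U = 0" and V: "integrable M V" "expectation V = 0"
  shows "(u + v) / 2 + expectation (\<lambda>x. \<bar>U x - V x\<bar>) / 4
    \<le> expectation (\<lambda>x. max (u + U x) (v + V x))"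
proof -
  have "max (u + U x) (v + V x) = (u + v) / 2 + U x / 2 + V x / 2 + \<bar>(u - v) + (U x - V x)\<bar> / 2" for x
    by (simp add: max_def abs_if field_simps)
  then have "expectation (\<lambda>x. max (u + U x) (v + V x))
      = (u + v) / 2 + expectation (\<lambda>x. \<bar>(u - v) + (U x - V x)\<bar>) / 2"
    using U V prob_space by simp
  then show ?thesis
    using expectation_abs_shift_ge[of "\<lambda>x. U x - V x" "u - v"] U V by simp
qed

lemma sum_pairs: "(\<Sum>i<2 * m. h i) = (\<Sum>p<m. h (2 * p) + h (2 * p + 1))" for h :: "nat \<Rightarrow> 'a::comm_monoid_add"
  by (induction m) (simp_all add: add.assoc)

section \<open>Maximizing finitely many linear forms of the input\<close>

locale linear_optimization = centred_inputs P E for P :: "real measure" and E :: "'e set" +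
  fixes S :: "'s set" and a :: "'s \<Rightarrow> 'e \<Rightarrow> real"
  assumes finite_S: "finite S" and S_nonempty: "S \<noteq> {}"
begin

definition dot :: "'s \<Rightarrow> ('e \<Rightarrow> real) \<Rightarrow> real" where
  "dot s x = (\<Sum>e\<in>E. a s e * x e)"

definition opt :: "('e \<Rightarrow> real) \<Rightarrow> real" where
  "opt x = Max ((\<lambda>s. dot s x) ` S)"

lemma dot_le_opt: "s \<in> S \<Longrightarrow> dot s x \<le> opt x"
  unfolding opt_def by (intro Max_ge) (use finite_S in auto)

lemma opt_attained: obtains s where "s \<in> S" "dot s x = opt x"
proof -
  have "opt x \<in> (\<lambda>s. dot s x) ` S"
    unfolding opt_def by (intro Max_in) (use finite_S S_nonempty in auto)
  then show ?thesis using that by auto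
qed

lemma lin_bounded_dot: "lin_bounded (dot s)"
  unfolding dot_def[abs_def] by (rule lin_bounded_linear) simp

lemma lin_bounded_opt: "lin_bounded opt"
  unfolding opt_def[abs_def] by (intro lin_bounded_Max finite_S S_nonempty lin_bounded_dot)

end

section \<open>Gain and cost of refreshing one block\<close>

locale block_optimization = linear_optimization P E S a + block_resampling P E C blk
  for P :: "real measure" and E :: "'e set" and S :: "'s set" and a :: "'s \<Rightarrow> 'e \<Rightarrow> real"
    and C :: "'c set" and blk :: "'e \<Rightarrow> 'c"
begin

text \<open>The noise term of \<open>expectation_max_shift_ge\<close> averaged over the blocks. It
  involves only the coefficients and the law of the noise, so being well separated is a
  deterministic relation between configurations.\<close>

definition gain :: "'s \<Rightarrow> 's \<Rightarrow> real" where
  "gain k l = (\<Sum>c\<in>C. \<integral>w. \<bar>\<Sum>e\<in>block c. (a k e - a l e) * w e\<bar> \<partial>\<mu>) / (4 * real (card C))"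

lemma gain_nonneg: "0 \<le> gain k l"
  unfolding gain_def by (intro divide_nonneg_nonneg sum_nonneg integral_nonneg) auto

lemma dot_resample:
  "dot k (resample (block c) x w) = (dot k x - (\<Sum>e\<in>block c. a k e * x e)) + (\<Sum>e\<in>block c. a k e * w e)"
proof -
  have "dot k y = (\<Sum>e\<in>E - block c. a k e * y e) + (\<Sum>e\<in>block c. a k e * y e)" for y
    unfolding dot_def by (rule sum.subset_diff[OF block_subset finite_E])
  note this[of x] this[of "resample (block c) x w"]
  moreover have "(\<Sum>e\<in>block c. a k e * resample (block c) x w e) = (\<Sum>e\<in>block c. a k e * w e)"
    by (intro sum.cong) (auto simp: resample_apply subsetD[OF block_subset])
  moreover have "(\<Sum>e\<in>E - block c. a k e * resample (block c) x w e) = (\<Sum>e\<in>E - block c. a k e * x e)"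
    by (intro sum.cong) (auto simp: resample_apply)
  ultimately show ?thesis by simp
qed

text \<open>Refreshing a block destroys what \<open>k\<close> and \<open>l\<close> collect there. As
  the blocks partition \<open>E\<close>, the average loss is the midpoint of the two values divided
  by \<open>card C\<close>, hence at most \<open>opt x / card C\<close>; the fresh noise gives back
  at least \<open>gain k l\<close>.\<close>

lemma refresh_max_ge:
  assumes x: "x \<in> space \<mu>" and "k \<in> S" "l \<in> S"
  shows "(dot k x + dot l x) / 2 - opt x / card C + gain k l \<le> refresh (\<lambda>y. max (dot k y) (dot l y)) x"
proof -
  let ?B = "\<lambda>s c. \<Sum>e\<in>block c. a s e * x e"
  let ?D = "\<lambda>c. \<integral>w. \<bar>\<Sum>e\<in>block c. (a k e - a l e) * w e\<bar> \<partial>\<mu>"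
  have step: "((dot k x - ?B k c) + (dot l x - ?B l c)) / 2 + ?D c / 4
     \<le> (\<integral>w. max (dot k (resample (block c) x w)) (dot l (resample (block c) x w)) \<partial>\<mu>)" for c
    using PE.expectation_max_shift_ge[of "\<lambda>w. \<Sum>e\<in>block c. a k e * w e" "\<lambda>w. \<Sum>e\<in>block c. a l e * w e"
        "dot k x - ?B k c" "dot l x - ?B l c"]
    by (simp add: dot_resample integrable_linear integral_linear block_subset sum_subtractf left_diff_distrib)
  have "real (card C) * ((dot k x + dot l x) / 2) - (dot k x + dot l x) / 2 + (\<Sum>c\<in>C. ?D c) / 4
     = (\<Sum>c\<in>C. (dot k x + dot l x) / 2 - (?B k c + ?B l c) / 2 + ?D c / 4)"
    by (simp add: sum.distrib sum_subtractf sum_blocks dot_def flip: sum_divide_distrib)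
  also have "\<dots> \<le> (\<Sum>c\<in>C. \<integral>w. max (dot k (resample (block c) x w)) (dot l (resample (block c) x w)) \<partial>\<mu>)"
    using step by (intro sum_mono) (simp add: field_simps)
  finally have bound: "(real (card C) * ((dot k x + dot l x) / 2) - (dot k x + dot l x) / 2 + (\<Sum>c\<in>C. ?D c) / 4) / card C
     \<le> refresh (\<lambda>y. max (dot k y) (dot l y)) x"
    unfolding refresh_def by (intro divide_right_mono) auto
  have split: "(m * A - A + D / 4) / m = A - A / m + D / (4 * m)" if "0 < m" for m A D :: real
    using that by (simp add: field_simps)
  have "((dot k x + dot l x) / 2) - ((dot k x + dot l x) / 2) / card C + gain k l
     \<le> refresh (\<lambda>y. max (dot k y) (dot l y)) x"
    using bound unfolding split[OF card_C_pos] gain_def .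
  moreover have "((dot k x + dot l x) / 2) / card C \<le> opt x / card C"
    using dot_le_opt[OF \<open>k \<in> S\<close>, of x] dot_le_opt[OF \<open>l \<in> S\<close>, of x] card_C_pos
    by (intro divide_right_mono) auto
  ultimately show ?thesis by linarith
qed

text \<open>A knock-out tournament: in each round one random block is refreshed, the competitors are
  paired and the better one of each pair survives. A round raises the average value of the
  survivors by at least \<open>g\<close>, and costs on average the share of the refreshed block in
  the current optimum.\<close>

lemma tournament:
  fixes \<sigma> :: "nat \<Rightarrow> 's"
  assumes "x \<in> space \<mu>" "\<And>i. i < 2 ^ T \<Longrightarrow> \<sigma> i \<in> S"
    and "\<And>i j. i < 2 ^ T \<Longrightarrow> j < 2 ^ T \<Longrightarrow> i \<noteq> j \<Longrightarrow> g \<le> gain (\<sigma> i) (\<sigma> j)"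
  shows "(\<Sum>i<2 ^ T. dot (\<sigma> i) x) / 2 ^ T + real T * g - (\<Sum>t<T. (refresh ^^ t) opt x) / card C
    \<le> (refresh ^^ T) opt x"
  using assms
proof (induction T arbitrary: x \<sigma>)
  case 0
  have "(\<Sum>i<2 ^ 0. dot (\<sigma> i) x) = dot (\<sigma> 0) x"
    unfolding power_0 One_nat_def by simp
  then show ?case using dot_le_opt[of "\<sigma> 0" x] 0 by simp
next
  case (Suc T)
  define G where "G = (\<lambda>p y. max (dot (\<sigma> (2 * p)) y) (dot (\<sigma> (2 * p + 1)) y))"
  have lG: "lin_bounded (G p)" for p
    unfolding G_def by (intro lin_bounded_max lin_bounded_dot)
  have in_S: "\<sigma> (2 * p) \<in> S" "\<sigma> (2 * p + 1) \<in> S" if "p < 2 ^ T" for p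
    using that by (auto intro!: Suc.prems(2))
  \<comment> \<open>The induction hypothesis is applied at each possible refreshed point
    \<open>y\<close>, with the winners \<open>w p\<close> determined at that point; this is why
    \<open>x\<close> and \<open>\<sigma>\<close> are generalized.\<close>
  have survivors: "(\<Sum>p<2 ^ T. G p y) / 2 ^ T + real T * g - (\<Sum>t<T. (refresh ^^ t) opt y) / card C
      \<le> (refresh ^^ T) opt y" if y: "y \<in> space \<mu>" for y
  proof -
    define w where "w = (\<lambda>p. if dot (\<sigma> (2 * p)) y \<ge> dot (\<sigma> (2 * p + 1)) y then 2 * p else 2 * p + 1)"
    have w: "w p = 2 * p \<or> w p = 2 * p + 1" for p by (simp add: w_def)
    have wlt: "w p < 2 ^ Suc T" if "p < 2 ^ T" for p using w[of p] that by auto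
    have wneq: "w p \<noteq> w q" if "p \<noteq> q" for p q using w[of p] w[of q] that by presburger
    have "G p y = dot (\<sigma> (w p)) y" for p by (simp add: G_def w_def max_def)
    then show ?thesis
      using Suc.IH[of y "\<lambda>p. \<sigma> (w p)"] y Suc.prems(2) Suc.prems(3) wlt wneq by simp
  qed
  \<comment> \<open>The lower bound of \<open>survivors\<close> as a function of \<open>y\<close>.
    Monotonicity and linearity of \<open>refresh\<close> carry it back to \<open>x\<close>, where
    \<open>refresh_max_ge\<close> evaluates the first round.\<close>
  define L where "L = (\<lambda>y. (1 / 2 ^ T) * (\<Sum>p<2 ^ T. G p y) + (real T * g + (- 1 / card C) * (\<Sum>t<T. (refresh ^^ t) opt y)))"
  note lins = lin_bounded_add lin_bounded_cmult lin_bounded_sum lin_bounded_const lG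
    lin_bounded_refresh_funpow[OF lin_bounded_opt]
  have lL: "lin_bounded L" unfolding L_def by (intro lins)
  have "refresh L x \<le> refresh ((refresh ^^ T) opt) x"
  proof (rule refresh_mono[OF lL])
    fix y assume "y \<in> space \<mu>"
    then show "L y \<le> (refresh ^^ T) opt y"
      using survivors[of y] unfolding L_def by (simp add: add_diff_eq)
  qed (use Suc.prems(1) lins in auto)
  moreover have "refresh L x = (1 / 2 ^ T) * (\<Sum>p<2 ^ T. refresh (G p) x)
      + (real T * g + (- 1 / card C) * (\<Sum>t<T. refresh ((refresh ^^ t) opt) x))"
  proof -
    let ?A = "\<lambda>y. \<Sum>p<2 ^ T. G p y" and ?B = "\<lambda>y. \<Sum>t<T. (refresh ^^ t) opt y"
    have "refresh L x = refresh (\<lambda>y. (1 / 2 ^ T) * ?A y) x + refresh (\<lambda>y. real T * g + (- 1 / card C) * ?B y) x"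
      unfolding L_def using Suc.prems(1) by (intro refresh_add lins)
    also have "refresh (\<lambda>y. real T * g + (- 1 / card C) * ?B y) x
        = refresh (\<lambda>_. real T * g) x + refresh (\<lambda>y. (- 1 / card C) * ?B y) x"
      using Suc.prems(1) by (intro refresh_add lins)
    also have "refresh ?A x = (\<Sum>p<2 ^ T. refresh (G p) x)"
      using Suc.prems(1) by (intro refresh_sum lins)
    moreover have "refresh ?B x = (\<Sum>t<T. refresh ((refresh ^^ t) opt) x)"
      using Suc.prems(1) by (intro refresh_sum lins)
    ultimately show ?thesis by (simp only: refresh_cmult refresh_const)
  qed
  moreover have round: "(\<Sum>p<2 ^ T. (dot (\<sigma> (2 * p)) x + dot (\<sigma> (2 * p + 1)) x) / 2 - opt x / card C + g)
      \<le> (\<Sum>p<2 ^ T. refresh (G p) x)"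
  proof (rule sum_mono)
    fix p assume "p \<in> {..<2 ^ T::nat}"
    then have p: "p < 2 ^ T" by simp
    have "g \<le> gain (\<sigma> (2 * p)) (\<sigma> (2 * p + 1))" using p by (intro Suc.prems(3)) auto
    then show "(dot (\<sigma> (2 * p)) x + dot (\<sigma> (2 * p + 1)) x) / 2 - opt x / card C + g \<le> refresh (G p) x"
      using refresh_max_ge[OF Suc.prems(1) in_S[OF p]] unfolding G_def by linarith
  qed
  have sum_round: "(\<Sum>p<2 ^ T. (dot (\<sigma> (2 * p)) x + dot (\<sigma> (2 * p + 1)) x) / 2 - opt x / card C + g)
      = (\<Sum>i<2 ^ Suc T. dot (\<sigma> i) x) / 2 + 2 ^ T * (g - opt x / card C)"
    using sum_pairs[of "\<lambda>i. dot (\<sigma> i) x" "2 ^ T"]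
    by (simp add: sum.distrib sum_subtractf algebra_simps flip: sum_divide_distrib)
  \<comment> \<open>The first round costs a share of \<open>opt x\<close> itself, each later round a
    share of an already refreshed \<open>opt\<close>.\<close>
  moreover have "(\<Sum>t<Suc T. (refresh ^^ t) opt x) = opt x + (\<Sum>t<T. refresh ((refresh ^^ t) opt) x)"
    by (subst sum.lessThan_Suc_shift) simp
  moreover have "(\<Sum>i<2 ^ Suc T. dot (\<sigma> i) x) / 2 ^ Suc T + (g - opt x / card C) \<le> (1 / 2 ^ T) * (\<Sum>p<2 ^ T. refresh (G p) x)"
    using mult_left_mono[OF round[unfolded sum_round], of "1 / 2 ^ T"] by (simp add: field_simps)
  moreover have "real (Suc T) * g = real T * g + g" by (simp add: algebra_simps)
  ultimately show ?case by (simp add: add_divide_distrib)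
qed

definition spread_near_optima :: "nat \<Rightarrow> real \<Rightarrow> real \<Rightarrow> ('e \<Rightarrow> real) set" where
  "spread_near_optima T g \<kappa> = {x \<in> space \<mu>. \<exists>U\<in>Pow S. card U = 2 ^ T \<and>
     (\<forall>u\<in>U. opt x - \<kappa> \<le> dot u x) \<and> (\<forall>u\<in>U. \<forall>v\<in>U. u \<noteq> v \<longrightarrow> g \<le> gain u v)}"

text \<open>Separation does not involve \<open>x\<close>, so the event is a finite union over the
  admissible sets \<open>U\<close>.\<close>

lemma sets_spread_near_optima: "spread_near_optima T g \<kappa> \<in> sets \<mu>"
proof -
  have "spread_near_optima T g \<kappa> = (\<Union>U \<in> {U. U \<subseteq> S \<and> card U = 2 ^ T \<and> (\<forall>u\<in>U. \<forall>v\<in>U. u \<noteq> v \<longrightarrow> g \<le> gain u v)}.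
      {x \<in> space \<mu>. \<forall>u\<in>U. opt x - \<kappa> \<le> dot u x})"
    unfolding spread_near_optima_def by auto
  also have "\<dots> \<in> sets \<mu>"
  proof (intro sets.finite_UN)
    show "finite {U. U \<subseteq> S \<and> card U = 2 ^ T \<and> (\<forall>u\<in>U. \<forall>v\<in>U. u \<noteq> v \<longrightarrow> g \<le> gain u v)}"
      by (rule finite_subset[of _ "Pow S"]) (use finite_S in auto)
    fix U assume "U \<in> {U. U \<subseteq> S \<and> card U = 2 ^ T \<and> (\<forall>u\<in>U. \<forall>v\<in>U. u \<noteq> v \<longrightarrow> g \<le> gain u v)}"
    then have "finite U" using finite_S finite_subset by auto
    have [measurable]: "opt \<in> borel_measurable \<mu>" "\<And>u. dot u \<in> borel_measurable \<mu>"
      using lin_bounded_opt lin_bounded_dot by (auto intro: measurable_lin_bounded)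
    have "{x \<in> space \<mu>. opt x - \<kappa> \<le> dot u x} \<in> sets \<mu>" for u by measurable
    with \<open>finite U\<close> show "{x \<in> space \<mu>. \<forall>u\<in>U. opt x - \<kappa> \<le> dot u x} \<in> sets \<mu>"
      by (intro sets.sets_Collect_finite_All)
  qed
  finally show ?thesis .
qed

text \<open>Refreshing preserves the mean, so \<open>opt\<close> cancels against
  \<open>(refresh ^^ T) opt\<close>. What remains is the net gain collected on the event, paid for
  by \<open>T\<close> shares of the mean optimum.\<close>

lemma prob_spread_near_optima:
  "measure \<mu> (spread_near_optima T g \<kappa>) * (real T * g - \<kappa>) \<le> real T * (\<integral>x. opt x \<partial>\<mu>) / card C"
proof -
  let ?G = "spread_near_optima T g \<kappa>"
  let ?cost = "\<lambda>x. (\<Sum>t<T. (refresh ^^ t) opt x) / card C"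
  have pt: "opt x + indicator ?G x * (real T * g - \<kappa>) - ?cost x \<le> (refresh ^^ T) opt x"
    if x: "x \<in> space \<mu>" for x
  proof (cases "x \<in> ?G")
    case True
    then have "\<exists>U\<in>Pow S. card U = 2 ^ T \<and> (\<forall>u\<in>U. opt x - \<kappa> \<le> dot u x) \<and>
        (\<forall>u\<in>U. \<forall>v\<in>U. u \<noteq> v \<longrightarrow> g \<le> gain u v)"
      unfolding spread_near_optima_def by (elim CollectE conjE)
    then obtain U where U: "U \<subseteq> S" "card U = 2 ^ T" and near: "\<forall>u\<in>U. opt x - \<kappa> \<le> dot u x"
      and spread: "\<forall>u\<in>U. \<forall>v\<in>U. u \<noteq> v \<longrightarrow> g \<le> gain u v"
      by (elim bexE conjE) (simp only: Pow_iff)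
    have "finite U" using U(1) finite_S finite_subset by blast
    then obtain \<sigma> where "bij_betw \<sigma> {0..<card U} U" using ex_bij_betw_nat_finite by blast
    then have \<sigma>: "inj_on \<sigma> {0..<2 ^ T}" "\<And>i. i < 2 ^ T \<Longrightarrow> \<sigma> i \<in> U"
      using U(2) by (auto simp: bij_betw_def)
    have "(\<Sum>i<2 ^ T. dot (\<sigma> i) x) / 2 ^ T + real T * g - ?cost x \<le> (refresh ^^ T) opt x"
    proof (rule tournament[OF x])
      show "g \<le> gain (\<sigma> i) (\<sigma> j)" if "i < 2 ^ T" "j < 2 ^ T" "i \<noteq> j" for i j
        using that \<sigma>(2) spread inj_onD[OF \<sigma>(1), of i j] by auto
    qed (use \<sigma>(2) U(1) in auto)
    moreover have "(\<Sum>i<2 ^ T::nat. opt x - \<kappa>) \<le> (\<Sum>i<2 ^ T. dot (\<sigma> i) x)"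
      using near \<sigma>(2) by (intro sum_mono) auto
    then have "opt x - \<kappa> \<le> (\<Sum>i<2 ^ T. dot (\<sigma> i) x) / 2 ^ T"
      by (simp add: field_simps)
    ultimately show ?thesis using True by simp
  next
    case False
    \<comment> \<open>Off the event, all players are copies of one optimizer and the guaranteed gain
      is 0.\<close>
    obtain s where s: "s \<in> S" "dot s x = opt x" by (rule opt_attained)
    have "(\<Sum>i<2 ^ T::nat. dot s x) / 2 ^ T + real T * 0 - ?cost x \<le> (refresh ^^ T) opt x"
      by (rule tournament[OF x, where \<sigma> = "\<lambda>_. s"]) (use s gain_nonneg in auto)
    then show ?thesis using s(2) False by simp
  qed
  note ints = integrable_lin_bounded[OF lin_bounded_refresh_funpow[OF lin_bounded_opt]]
    integrable_lin_bounded[OF lin_bounded_opt]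
  have iG: "integrable \<mu> (\<lambda>x. indicator ?G x :: real)"
    by (rule integrable_lin_bounded, rule lin_bounded_mono[OF lin_bounded_const[of 1], of _ 1])
      (auto simp: indicator_def intro: borel_measurable_indicator[OF sets_spread_near_optima, of T g \<kappa>, unfolded indicator_def])
  have "(\<integral>x. opt x + indicator ?G x * (real T * g - \<kappa>) - ?cost x \<partial>\<mu>) \<le> (\<integral>x. (refresh ^^ T) opt x \<partial>\<mu>)"
    using ints iG by (intro integral_mono pt) auto
  moreover have "(\<integral>x. ?cost x \<partial>\<mu>) = real T * (\<integral>x. opt x \<partial>\<mu>) / card C"
    using ints(1) by (simp add: integral_refresh_funpow lin_bounded_opt)
  moreover have "(\<integral>x. indicator ?G x \<partial>\<mu>) = measure \<mu> ?G"
    using sets_spread_near_optima[of T g \<kappa>] sets.sets_into_space by (simp add: Int_absorb2)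
  ultimately show ?thesis
    using ints iG by (simp add: integral_refresh_funpow lin_bounded_opt)
qed

end

section \<open>The mean optimum by exponential moments\<close>

context linear_optimization
begin

text \<open>The largest exponential is at most the sum over \<open>S\<close>. The tangent inequality
  \<open>u \<le> A + exp (u - A)\<close> replaces Jensen's inequality for the logarithm;
  \<open>A\<close> is chosen so that the rescaled sum has mean at most 1, which is the summand 1 in
  the bound.\<close>

lemma integral_opt_le:
  fixes \<theta> q :: real
  assumes signs: "\<And>s e. s \<in> S \<Longrightarrow> e \<in> E \<Longrightarrow> a s e \<in> {1, -1}"
    and "0 < \<theta>"
    and mgf_int: "integrable P (\<lambda>t. exp (\<theta> * t))" "integrable P (\<lambda>t. exp (- \<theta> * t))"
    and mgf: "(\<integral>t. exp (\<theta> * t) \<partial>P) \<le> exp q" "(\<integral>t. exp (- \<theta> * t) \<partial>P) \<le> exp q"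
  shows "(\<integral>x. opt x \<partial>\<mu>) \<le> (ln (card S) + card E * q + 1) / \<theta>"
proof -
  define A where "A = ln (card S) + card E * q"
  have cS: "0 < real (card S)" using finite_S S_nonempty by (simp add: card_gt_0_iff)
  have exp_dot: "exp (\<theta> * dot s x) = (\<Prod>e\<in>E. exp ((\<theta> * a s e) * x e))" for s x
    by (simp add: dot_def sum_distrib_left exp_sum finite_E mult.assoc)
  have sgn: "\<theta> * a s e = \<theta> \<or> \<theta> * a s e = - \<theta>" if "s \<in> S" "e \<in> E" for s e
    using signs[OF that] by auto
  have i1: "integrable P (\<lambda>t. exp ((\<theta> * a s e) * t))"
    and m1: "(\<integral>t. exp ((\<theta> * a s e) * t) \<partial>P) \<le> exp q" if "s \<in> S" "e \<in> E" for s e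
    using sgn[OF that] mgf_int mgf by auto
  have iexp: "integrable \<mu> (\<lambda>x. exp (\<theta> * dot s x))" if "s \<in> S" for s
    unfolding exp_dot using that by (intro PE.product_integrable_prod finite_E i1)
  have mexp: "(\<integral>x. exp (\<theta> * dot s x) \<partial>\<mu>) \<le> exp (card E * q)" if "s \<in> S" for s
  proof -
    have "(\<integral>x. exp (\<theta> * dot s x) \<partial>\<mu>) = (\<Prod>e\<in>E. \<integral>t. exp ((\<theta> * a s e) * t) \<partial>P)"
      unfolding exp_dot using that by (intro PE.product_integral_prod finite_E i1)
    also have "\<dots> \<le> (\<Prod>e\<in>E. exp q)"
      using that by (intro prod_mono) (auto intro: m1)
    finally show ?thesis by (simp add: exp_of_nat_mult)
  qed
  have pt: "opt x \<le> (A + exp (- A) * (\<Sum>s\<in>S. exp (\<theta> * dot s x))) / \<theta>" for x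
  proof -
    obtain s where s: "s \<in> S" "dot s x = opt x" by (rule opt_attained)
    have "\<theta> * opt x \<le> A + exp (\<theta> * opt x - A)"
      using exp_ge_add_one_self[of "\<theta> * opt x - A"] by linarith
    also have "exp (\<theta> * opt x - A) = exp (- A) * exp (\<theta> * dot s x)"
      by (simp add: s(2) flip: exp_add)
    also have "\<dots> \<le> exp (- A) * (\<Sum>s\<in>S. exp (\<theta> * dot s x))"
      using s(1) finite_S by (intro mult_left_mono member_le_sum) auto
    finally show ?thesis using \<open>0 < \<theta>\<close> by (simp add: field_simps)
  qed
  have isum: "integrable \<mu> (\<lambda>x. \<Sum>s\<in>S. exp (\<theta> * dot s x))"
    by (intro Bochner_Integration.integrable_sum iexp)
  have "(\<integral>x. opt x \<partial>\<mu>) \<le> (\<integral>x. (A + exp (- A) * (\<Sum>s\<in>S. exp (\<theta> * dot s x))) / \<theta> \<partial>\<mu>)"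
    using isum by (intro integral_mono pt integrable_lin_bounded[OF lin_bounded_opt]) simp_all
  also have "\<dots> = (A + exp (- A) * (\<integral>x. (\<Sum>s\<in>S. exp (\<theta> * dot s x)) \<partial>\<mu>)) / \<theta>"
    using isum measure_space_mu by simp
  also have "(\<integral>x. (\<Sum>s\<in>S. exp (\<theta> * dot s x)) \<partial>\<mu>) = (\<Sum>s\<in>S. \<integral>x. exp (\<theta> * dot s x) \<partial>\<mu>)"
    by (intro Bochner_Integration.integral_sum iexp)
  also have "(A + exp (- A) * \<dots>) / \<theta> \<le> (A + exp (- A) * (\<Sum>s\<in>S. exp (card E * q))) / \<theta>"
    using \<open>0 < \<theta>\<close> by (intro divide_right_mono add_left_mono mult_left_mono sum_mono mexp) auto
  also have "exp (- A) * (\<Sum>s\<in>S. exp (card E * q)) = 1"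
    using cS by (simp add: A_def exp_minus exp_add exp_diff)
  finally show ?thesis by (simp add: A_def)
qed

section \<open>Near-optimality of the perturbed optimizers\<close>

text \<open>The uniform distribution on the set of optimizers: a measurable substitute for a choice of
  one of them.\<close>

definition argmax_weight :: "'s \<Rightarrow> ('e \<Rightarrow> real) \<Rightarrow> real" where
  "argmax_weight s x = (if dot s x = opt x then 1 / card {t \<in> S. dot t x = opt x} else 0)"

lemma card_argmax_pos: "0 < card {t \<in> S. dot t x = opt x}"
  using opt_attained[of x] finite_S by (auto simp: card_gt_0_iff)

lemma argmax_weight_nonneg: "0 \<le> argmax_weight s x"
  by (simp add: argmax_weight_def)

lemma sum_argmax_weight: "(\<Sum>s\<in>S. argmax_weight s x) = 1"
  unfolding argmax_weight_def sum.inter_filter[OF finite_S, symmetric]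
  using card_argmax_pos[of x] by simp

lemma argmax_weight_le_1: "argmax_weight s x \<le> 1"
  using card_argmax_pos[of x] by (simp add: argmax_weight_def)

lemma sum_argmax_weight_dot: "(\<Sum>s\<in>S. argmax_weight s x * dot s x) = opt x"
proof -
  have "(\<Sum>s\<in>S. argmax_weight s x * dot s x) = (\<Sum>s\<in>S. argmax_weight s x * opt x)"
    by (intro sum.cong) (simp_all add: argmax_weight_def)
  also have "\<dots> = opt x"
    unfolding sum_distrib_right[symmetric] sum_argmax_weight by simp
  finally show ?thesis .
qed

lemma average_dot_le_opt:
  assumes "\<And>s. s \<in> S \<Longrightarrow> 0 \<le> p s" and "(\<Sum>s\<in>S. p s) = 1"
  shows "(\<Sum>s\<in>S. p s * dot s x) \<le> opt x"
proof -
  have "(\<Sum>s\<in>S. p s * dot s x) \<le> (\<Sum>s\<in>S. p s * opt x)"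
    by (intro sum_mono mult_left_mono dot_le_opt assms(1))
  also have "\<dots> = opt x"
    unfolding sum_distrib_right[symmetric] assms(2) by simp
  finally show ?thesis .
qed

lemma measurable_argmax_weight [measurable]: "argmax_weight s \<in> borel_measurable \<mu>"
proof -
  have [measurable]: "opt \<in> borel_measurable \<mu>" "\<And>u. dot u \<in> borel_measurable \<mu>"
    using lin_bounded_opt lin_bounded_dot by (auto intro: measurable_lin_bounded)
  have "argmax_weight s = (\<lambda>x. if dot s x = opt x then 1 / (\<Sum>t\<in>S. if dot t x = opt x then 1 else 0) else 0)"
    by (simp add: fun_eq_iff argmax_weight_def finite_S flip: sum.inter_filter)
  then show ?thesis by simp
qed

text \<open>Averaging over ties keeps this measurable; where the perturbed optimizer is unique, it
  is the loss of the one that \<open>arg_min_on\<close> selects.\<close>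

definition regret :: "'e set \<Rightarrow> ('e \<Rightarrow> real) \<Rightarrow> ('e \<Rightarrow> real) \<Rightarrow> real" where
  "regret J x y = opt x - (\<Sum>s\<in>S. argmax_weight s (resample J x y) * dot s x)"

definition block_value :: "'e set \<Rightarrow> ('e \<Rightarrow> real) \<Rightarrow> real" where
  "block_value J x = (\<Sum>s\<in>S. argmax_weight s x * (\<Sum>e\<in>J. a s e * x e))"

lemma regret_nonneg: "0 \<le> regret J x y"
  using average_dot_le_opt[of "\<lambda>s. argmax_weight s (resample J x y)" x]
  by (simp add: regret_def argmax_weight_nonneg sum_argmax_weight)

lemma dot_resample_diff:
  assumes "J \<subseteq> E"
  shows "dot s (resample J x y) - dot s x = (\<Sum>e\<in>J. a s e * y e) - (\<Sum>e\<in>J. a s e * x e)"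
proof -
  have "dot s z = (\<Sum>e\<in>E - J. a s e * z e) + (\<Sum>e\<in>J. a s e * z e)" for z
    unfolding dot_def by (rule sum.subset_diff[OF assms finite_E])
  note this[of x] this[of "resample J x y"]
  moreover have "(\<Sum>e\<in>J. a s e * resample J x y e) = (\<Sum>e\<in>J. a s e * y e)"
    by (intro sum.cong) (auto simp: resample_apply subsetD[OF assms])
  moreover have "(\<Sum>e\<in>E - J. a s e * resample J x y e) = (\<Sum>e\<in>E - J. a s e * x e)"
    by (intro sum.cong) (auto simp: resample_apply)
  ultimately show ?thesis by simp
qed

text \<open>Testing the perturbed problem with the old optimizers bounds its optimum from below.
  Writing both comparisons through the change on \<open>J\<close> leaves two block values minus two
  mixed terms, whose weights and values stem from different inputs. The mixed terms are split edge
  by edge so that each has a computable mean.\<close>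

lemma regret_le:
  assumes J: "J \<subseteq> E"
  defines "x' \<equiv> \<lambda>x y. resample J x y"
  shows "regret J x y \<le> block_value J x + block_value J (resample J x y)
     - (\<Sum>s\<in>S. \<Sum>e\<in>J. a s e * (argmax_weight s x * y e))
     - (\<Sum>s\<in>S. \<Sum>e\<in>J. a s e * (argmax_weight s (resample J x y) * x e))"
proof -
  let ?z = "resample J x y"
  let ?R = "\<lambda>s u. \<Sum>e\<in>J. a s e * u e"
  have "(\<Sum>s\<in>S. argmax_weight s x * dot s ?z) \<le> opt ?z"
    by (rule average_dot_le_opt) (simp_all add: argmax_weight_nonneg sum_argmax_weight)
  moreover have "(\<Sum>s\<in>S. argmax_weight s x * dot s ?z) = opt x + (\<Sum>s\<in>S. argmax_weight s x * (?R s y - ?R s x))"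
    unfolding dot_resample_diff[OF J, symmetric] right_diff_distrib sum_subtractf sum_argmax_weight_dot
    by simp
  moreover have "opt ?z = (\<Sum>s\<in>S. argmax_weight s ?z * dot s x) + (\<Sum>s\<in>S. argmax_weight s ?z * (?R s y - ?R s x))"
    unfolding dot_resample_diff[OF J, symmetric] right_diff_distrib sum_subtractf sum_argmax_weight_dot
    by simp
  moreover have "?R s y = ?R s ?z" for s
    by (intro sum.cong) (auto simp: resample_apply subsetD[OF J])
  then have "(\<Sum>s\<in>S. argmax_weight s ?z * (?R s y - ?R s x)) = block_value J ?z - (\<Sum>s\<in>S. argmax_weight s ?z * ?R s x)"
    by (simp add: block_value_def right_diff_distrib sum_subtractf)
  moreover have "(\<Sum>s\<in>S. argmax_weight s x * (?R s y - ?R s x)) = (\<Sum>s\<in>S. argmax_weight s x * ?R s y) - block_value J x"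
    by (simp add: block_value_def right_diff_distrib sum_subtractf)
  moreover have "(\<Sum>s\<in>S. argmax_weight s x * ?R s y) = (\<Sum>s\<in>S. \<Sum>e\<in>J. a s e * (argmax_weight s x * y e))"
    "(\<Sum>s\<in>S. argmax_weight s ?z * ?R s x) = (\<Sum>s\<in>S. \<Sum>e\<in>J. a s e * (argmax_weight s ?z * x e))"
    by (simp_all add: sum_distrib_left sum_distrib_right mult_ac)
  ultimately show ?thesis unfolding regret_def by linarith
qed

lemma lin_bounded_weighted:
  assumes "w \<in> borel_measurable \<mu>" "\<And>x. \<bar>w x\<bar> \<le> 1" "lin_bounded F"
  shows "lin_bounded (\<lambda>x. w x * F x)"
proof (rule lin_bounded_mono[OF assms(3), of _ 1])
  show "\<bar>w x * F x\<bar> \<le> 1 * \<bar>F x\<bar>" for x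
    using mult_right_mono[OF assms(2), of "\<bar>F x\<bar>" x] by (simp add: abs_mult)
qed (use assms(1) measurable_lin_bounded[OF assms(3)] in auto)

lemma abs_argmax_weight_le_1: "\<bar>argmax_weight s x\<bar> \<le> 1"
  using argmax_weight_nonneg[of s x] argmax_weight_le_1[of s x] by simp

lemma lin_bounded_block_value: "J \<subseteq> E \<Longrightarrow> lin_bounded (block_value J)"
  unfolding block_value_def[abs_def]
  by (intro lin_bounded_sum lin_bounded_weighted[OF measurable_argmax_weight abs_argmax_weight_le_1]
      lin_bounded_linear)

text \<open>Double counting. In the application \<open>k\<close> is 2, because a coupling belongs to
  the blocks of both its sites.\<close>

lemma sum_block_value:
  assumes "finite N" "\<And>i. i \<in> N \<Longrightarrow> J i \<subseteq> E" "\<And>e. e \<in> E \<Longrightarrow> card {i \<in> N. e \<in> J i} = k"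
  shows "(\<Sum>i\<in>N. block_value (J i) x) = real k * opt x"
proof -
  have "(\<Sum>i\<in>N. \<Sum>e\<in>J i. a s e * x e) = real k * dot s x" for s
  proof -
    have "(\<Sum>i\<in>N. \<Sum>e\<in>J i. a s e * x e) = (\<Sum>i\<in>N. \<Sum>e\<in>{e \<in> E. e \<in> J i}. a s e * x e)"
      using assms(2) by (intro sum.cong) auto
    also have "\<dots> = (\<Sum>e\<in>E. \<Sum>i\<in>{i \<in> N. e \<in> J i}. a s e * x e)"
      by (rule sum.swap_restrict[OF assms(1) finite_E])
    also have "\<dots> = real k * dot s x"
      by (simp add: assms(3) dot_def sum_distrib_left)
    finally show ?thesis .
  qed
  note row = this
  have "(\<Sum>i\<in>N. block_value (J i) x) = (\<Sum>s\<in>S. argmax_weight s x * (\<Sum>i\<in>N. \<Sum>e\<in>J i. a s e * x e))"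
    unfolding block_value_def by (subst sum.swap) (simp add: sum_distrib_left)
  also have "\<dots> = real k * opt x"
    by (simp add: row sum_distrib_left mult.left_commute flip: sum_argmax_weight_dot)
  finally show ?thesis .
qed

text \<open>Projection to the first factor is resampling of the empty block, so this is a case of
  \<open>integrable_pair_resample\<close>; the second factor corresponds to the block
  \<open>E\<close>.\<close>

lemma integrable_pair_fst: "lin_bounded F \<Longrightarrow> integrable (\<mu> \<Otimes>\<^sub>M \<mu>) (\<lambda>z. F (fst z))"
proof -
  assume F: "lin_bounded F"
  have "integrable (\<mu> \<Otimes>\<^sub>M \<mu>) (\<lambda>z. F (fst z)) = integrable (\<mu> \<Otimes>\<^sub>M \<mu>) (\<lambda>(x, y). F (resample {} x y))"
    by (intro Bochner_Integration.integrable_cong)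
      (auto simp: space_pair_measure resample_def space_mu PiE_def extensional_restrict)
  then show ?thesis using integrable_pair_resample[OF F, of "{}"] by simp
qed

lemma integrable_pair_snd: "lin_bounded F \<Longrightarrow> integrable (\<mu> \<Otimes>\<^sub>M \<mu>) (\<lambda>z. F (snd z))"
proof -
  assume F: "lin_bounded F"
  have "resample E x y = y" if "y \<in> space \<mu>" for x y
    using that by (auto simp: resample_def space_mu PiE_def extensional_def fun_eq_iff)
  then have "integrable (\<mu> \<Otimes>\<^sub>M \<mu>) (\<lambda>z. F (snd z)) = integrable (\<mu> \<Otimes>\<^sub>M \<mu>) (\<lambda>(x, y). F (resample E x y))"
    by (intro Bochner_Integration.integrable_cong) (auto simp: space_pair_measure)
  then show ?thesis using integrable_pair_resample[OF F, of E] by simp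
qed

lemma integrable_pair_weighted:
  assumes "w \<in> borel_measurable (\<mu> \<Otimes>\<^sub>M \<mu>)" "\<And>z. \<bar>w z\<bar> \<le> 1" "integrable (\<mu> \<Otimes>\<^sub>M \<mu>) (F :: _ \<Rightarrow> real)"
  shows "integrable (\<mu> \<Otimes>\<^sub>M \<mu>) (\<lambda>z. w z * F z)"
proof (rule Bochner_Integration.integrable_bound[OF assms(3)])
  show "AE z in \<mu> \<Otimes>\<^sub>M \<mu>. norm (w z * F z) \<le> norm (F z)"
  proof (rule AE_I2)
    show "norm (w z * F z) \<le> norm (F z)" for z
      using mult_right_mono[OF assms(2), of "\<bar>F z\<bar>" z] by (simp add: abs_mult)
  qed
qed (use assms in auto)

lemma measurable_pair_argmax_weight [measurable]:
  "(\<lambda>z. argmax_weight s (resample J (fst z) (snd z))) \<in> borel_measurable (\<mu> \<Otimes>\<^sub>M \<mu>)"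
  using measurable_compose[OF measurable_resample_pair measurable_argmax_weight] by (simp add: split_beta')

lemma integrable_regret: "integrable (\<mu> \<Otimes>\<^sub>M \<mu>) (\<lambda>z. regret J (fst z) (snd z))"
  unfolding regret_def
  by (intro Bochner_Integration.integrable_diff Bochner_Integration.integrable_sum
      integrable_pair_weighted measurable_pair_argmax_weight abs_argmax_weight_le_1)
    (intro integrable_pair_fst lin_bounded_opt lin_bounded_dot)+

text \<open>Replacing the block \<open>J\<close> leaves the new optimizer independent of the old values on \<open>J\<close>, and
  the old optimizer independent of the new ones; only the two diagonal terms of
  the previous estimate survive, and they have the same law.\<close>

lemma integral_regret_le:
  assumes J: "J \<subseteq> E"
  shows "(\<integral>z. regret J (fst z) (snd z) \<partial>(\<mu> \<Otimes>\<^sub>M \<mu>)) \<le> 2 * (\<integral>x. block_value J x \<partial>\<mu>)"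
proof -
  let ?N = "\<mu> \<Otimes>\<^sub>M \<mu>"
  let ?V1 = "\<lambda>z. block_value J (fst z)" and ?V2 = "\<lambda>z. block_value J (resample J (fst z) (snd z))"
  let ?Q1 = "\<lambda>s e z. argmax_weight s (fst z) * snd z e"
  let ?Q2 = "\<lambda>s e z. argmax_weight s (resample J (fst z) (snd z)) * fst z e"
  have e: "e \<in> E" if "e \<in> J" for e using that J by blast
  have i1: "integrable ?N ?V1" by (intro integrable_pair_fst lin_bounded_block_value J)
  have i2: "integrable ?N ?V2" using integrable_pair_resample[OF lin_bounded_block_value[OF J], of J] by (simp add: split_beta')
  have iQ1: "integrable ?N (?Q1 s e)" if "e \<in> J" for s e
    using integrable_pair_snd[OF lin_bounded_coordinate[OF e[OF that]]]
    by (intro integrable_pair_weighted abs_argmax_weight_le_1) simp_all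
  have iQ2: "integrable ?N (?Q2 s e)" if "e \<in> J" for s e
    using integrable_pair_fst[OF lin_bounded_coordinate[OF e[OF that]]]
    by (intro integrable_pair_weighted abs_argmax_weight_le_1 measurable_pair_argmax_weight) simp_all
  have coord0: "(\<integral>y. y e \<partial>\<mu>) = 0" if "e \<in> E" for e
    using integral_linear[of "{e}" "\<lambda>_. 1"] that by simp
  have Q1: "(\<integral>z. ?Q1 s e z \<partial>?N) = 0" if "e \<in> J" for s e
    using pair.integral_fst'[OF iQ1[OF that], of s] coord0[OF e[OF that]] by simp
  have Q2: "(\<integral>z. ?Q2 s e z \<partial>?N) = 0" if "e \<in> J" for s e
  proof -
    \<comment> \<open>For fixed \<open>y\<close> the weight ignores \<open>x e\<close>, which is
      overwritten as \<open>e \<in> J\<close>; the integral factors and the coordinate has mean 0.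
      Hence the integration over \<open>x\<close> comes first here.\<close>
    have "(\<integral>x. argmax_weight s (resample J x y) * x e \<partial>\<mu>) = 0" if y: "y \<in> space \<mu>" for y
    proof -
      have m: "(\<lambda>x. argmax_weight s (resample J x y)) \<in> borel_measurable \<mu>"
        using y by (intro measurable_compose[OF measurable_resample measurable_argmax_weight]) auto
      have "integrable \<mu> (\<lambda>x. argmax_weight s (resample J x y))"
        by (rule PE.integrable_const_bound[of _ 1]) (use m abs_argmax_weight_le_1 in auto)
      moreover have "resample J (x(e := t)) y = resample J x y" for x t
        using \<open>e \<in> J\<close> by (auto simp: resample_def fun_eq_iff)
      ultimately show ?thesis
        using integral_coordinate_mult[OF e[OF \<open>e \<in> J\<close>] _ integrable_id, of "\<lambda>x. argmax_weight s (resample J x y)"]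
        by (simp add: mean_0)
    qed
    then have "(\<integral>y. \<integral>x. argmax_weight s (resample J x y) * x e \<partial>\<mu> \<partial>\<mu>) = 0"
      by (simp cong: Bochner_Integration.integral_cong)
    then show ?thesis
      using pair.integral_snd[of "\<lambda>x y. argmax_weight s (resample J x y) * x e"] iQ2[OF that, of s]
      by (simp add: split_beta')
  qed
  have V: "(\<integral>z. ?V1 z \<partial>?N) = (\<integral>x. block_value J x \<partial>\<mu>)" "(\<integral>z. ?V2 z \<partial>?N) = (\<integral>x. block_value J x \<partial>\<mu>)"
    using pair.integral_fst'[OF i1] pair.integral_fst'[OF i2] measure_space_mu
      integral_pair_resample[OF lin_bounded_block_value[OF J], of J] by simp_all
  let ?R = "\<lambda>z. ?V1 z + ?V2 z - (\<Sum>s\<in>S. \<Sum>e\<in>J. a s e * ?Q1 s e z) - (\<Sum>s\<in>S. \<Sum>e\<in>J. a s e * ?Q2 s e z)"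
  have iS1: "integrable ?N (\<lambda>z. \<Sum>s\<in>S. \<Sum>e\<in>J. a s e * ?Q1 s e z)"
    by (intro Bochner_Integration.integrable_sum integrable_mult_right iQ1)
  have iS2: "integrable ?N (\<lambda>z. \<Sum>s\<in>S. \<Sum>e\<in>J. a s e * ?Q2 s e z)"
    by (intro Bochner_Integration.integrable_sum integrable_mult_right iQ2)
  have S1: "(\<integral>z. (\<Sum>s\<in>S. \<Sum>e\<in>J. a s e * ?Q1 s e z) \<partial>?N) = 0"
    using iQ1 Q1 by (subst Bochner_Integration.integral_sum) (auto intro!: sum.neutral)
  have S2: "(\<integral>z. (\<Sum>s\<in>S. \<Sum>e\<in>J. a s e * ?Q2 s e z) \<partial>?N) = 0"
    using iQ2 Q2 by (subst Bochner_Integration.integral_sum) (auto intro!: sum.neutral)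
  have "(\<integral>z. regret J (fst z) (snd z) \<partial>?N) \<le> (\<integral>z. ?R z \<partial>?N)"
    by (intro integral_mono integrable_regret Bochner_Integration.integrable_diff
        Bochner_Integration.integrable_add i1 i2 iS1 iS2 regret_le J)
  also have "\<dots> = 2 * (\<integral>x. block_value J x \<partial>\<mu>)"
    using i1 i2 iS1 iS2 V S1 S2 by simp
  finally show ?thesis .
qed

text \<open>If the coefficients of \<open>s\<close> and \<open>t\<close> differ at \<open>e\<close>,
  then for given other coordinates they tie at a single value of the coordinate \<open>e\<close>,
  which has probability 0. Resampling \<open>e\<close> alone makes this conditioning
  precise.\<close>

lemma AE_unique_optimizer:
  assumes atomless: "\<And>c. AE t in P. t \<noteq> c"
    and separated: "\<And>s t. s \<in> S \<Longrightarrow> t \<in> S \<Longrightarrow> s \<noteq> t \<Longrightarrow> \<exists>e\<in>E. a s e \<noteq> a t e"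
  shows "AE x in \<mu>. \<forall>s\<in>S. \<forall>t\<in>S. dot s x = opt x \<longrightarrow> dot t x = opt x \<longrightarrow> s = t"
proof -
  have ne: "AE x in \<mu>. dot s x \<noteq> dot t x" if st: "s \<in> S" "t \<in> S" "s \<noteq> t" for s t
  proof -
    obtain e where e: "e \<in> E" "a s e \<noteq> a t e" using separated[OF st] by blast
    have [measurable]: "\<And>u. dot u \<in> borel_measurable \<mu>" using lin_bounded_dot by (rule measurable_lin_bounded)
    have mN: "(\<lambda>z. dot u (resample {e} (fst z) (snd z))) \<in> borel_measurable (\<mu> \<Otimes>\<^sub>M \<mu>)" for u
      using measurable_compose[OF measurable_resample_pair, of "dot u" borel] by (simp add: split_beta')
    have "AE z in \<mu> \<Otimes>\<^sub>M \<mu>. dot s (resample {e} (fst z) (snd z)) \<noteq> dot t (resample {e} (fst z) (snd z))"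
    proof (rule pair.AE_pair_measure)
      show "{z \<in> space (\<mu> \<Otimes>\<^sub>M \<mu>). dot s (resample {e} (fst z) (snd z)) \<noteq> dot t (resample {e} (fst z) (snd z))} \<in> sets (\<mu> \<Otimes>\<^sub>M \<mu>)"
        using mN[of s] mN[of t] by measurable
      show "AE x in \<mu>. AE w in \<mu>. dot s (resample {e} (fst (x, w)) (snd (x, w))) \<noteq> dot t (resample {e} (fst (x, w)) (snd (x, w)))"
      proof (rule AE_I2)
        fix x
        define c where "c = ((dot t x - a t e * x e) - (dot s x - a s e * x e)) / (a s e - a t e)"
        have "AE w in \<mu>. w e \<noteq> c"
          by (rule AE_PiM_component) (use P.prob_space_axioms e atomless in auto)
        moreover have "dot s (resample {e} x w) \<noteq> dot t (resample {e} x w)" if "w e \<noteq> c" for w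
          using that dot_resample_diff[of "{e}" s x w] dot_resample_diff[of "{e}" t x w] e
          by (auto simp: c_def field_simps)
        ultimately show "AE w in \<mu>. dot s (resample {e} (fst (x, w)) (snd (x, w))) \<noteq> dot t (resample {e} (fst (x, w)) (snd (x, w)))"
          by (auto elim: AE_mp)
      qed
    qed
    moreover have "{x \<in> space \<mu>. dot s x \<noteq> dot t x} \<in> sets \<mu>"
      by (intro borel_measurable_neq measurable_lin_bounded lin_bounded_dot)
    ultimately have "AE x in distr (\<mu> \<Otimes>\<^sub>M \<mu>) \<mu> (\<lambda>(x, w). resample {e} x w). dot s x \<noteq> dot t x"
      by (simp add: AE_distr_iff[OF measurable_resample_pair] split_beta')
    then show ?thesis by (simp only: distr_resample)
  qed
  have "AE x in \<mu>. \<forall>s\<in>S. \<forall>t\<in>S. s \<noteq> t \<longrightarrow> dot s x \<noteq> dot t x"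
    using ne by (intro AE_finite_allI finite_S) auto
  then show ?thesis by eventually_elim metis
qed

lemma argmax_weight_unique:
  assumes "\<forall>s\<in>S. \<forall>t\<in>S. dot s x = opt x \<longrightarrow> dot t x = opt x \<longrightarrow> s = t" and "s \<in> S" "dot s x = opt x" "t \<in> S"
  shows "argmax_weight t x = (if t = s then 1 else 0)"
proof -
  have "{t \<in> S. dot t x = opt x} = {s}" using assms by blast
  then show ?thesis using assms by (auto simp: argmax_weight_def)
qed

lemma regret_unique:
  assumes "\<forall>s\<in>S. \<forall>t\<in>S. dot s (resample J x y) = opt (resample J x y) \<longrightarrow> dot t (resample J x y) = opt (resample J x y) \<longrightarrow> s = t"
    and "s \<in> S" "dot s (resample J x y) = opt (resample J x y)"
  shows "regret J x y = opt x - dot s x"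
proof -
  have "(\<Sum>t\<in>S. argmax_weight t (resample J x y) * dot t x) = (\<Sum>t\<in>S. if t = s then dot t x else 0)"
    by (intro sum.cong refl) (simp add: argmax_weight_unique[OF assms])
  then show ?thesis using assms(2) finite_S by (simp add: regret_def)
qed

end

context block_optimization
begin

text \<open>As \<open>?A c \<le> 4 * b\<close>, the root of \<open>?A c\<close> is at least
  \<open>?A c / (2 * sqrt b)\<close>. This linear minorant adds up over the blocks to the whole
  squared distance, however that is spread among them.\<close>

lemma gain_ge:
  assumes "0 < var" "0 < b" and card_block: "\<And>c. c \<in> C \<Longrightarrow> real (card (block c)) \<le> b"
    and diff: "\<And>e. e \<in> E \<Longrightarrow> (a k e - a l e)\<^sup>2 \<le> 4"
  shows "l1_const * (\<Sum>e\<in>E. (a k e - a l e)\<^sup>2) / (8 * sqrt b * card C) \<le> gain k l"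
proof -
  let ?A = "\<lambda>c. \<Sum>e\<in>block c. (a k e - a l e)\<^sup>2"
  have le: "l1_const * (?A c / (2 * sqrt b)) \<le> (\<integral>w. \<bar>\<Sum>e\<in>block c. (a k e - a l e) * w e\<bar> \<partial>\<mu>)" if "c \<in> C" for c
  proof -
    have "?A c \<le> (\<Sum>e\<in>block c. 4)"
      by (intro sum_mono diff) (rule subsetD[OF block_subset])
    also have "\<dots> \<le> 4 * b" using card_block[OF that] by simp
    finally have "sqrt (?A c) \<le> 2 * sqrt b"
      using real_sqrt_le_mono[of "?A c" "4 * b"] by (simp add: real_sqrt_mult)
    moreover have "0 \<le> ?A c" by (intro sum_nonneg) auto
    ultimately have "sqrt (?A c) * sqrt (?A c) \<le> sqrt (?A c) * (2 * sqrt b)"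
      by (intro mult_left_mono) auto
    then have "?A c \<le> sqrt (?A c) * (2 * sqrt b)"
      using \<open>0 \<le> ?A c\<close> by simp
    then have "?A c / (2 * sqrt b) \<le> sqrt (?A c)"
      using \<open>0 < b\<close> by (simp add: field_simps)
    then have "l1_const * (?A c / (2 * sqrt b)) \<le> l1_const * sqrt (?A c)"
      by (intro mult_left_mono l1_const_nonneg)
    also have "\<dots> \<le> (\<integral>w. \<bar>\<Sum>e\<in>block c. (a k e - a l e) * w e\<bar> \<partial>\<mu>)"
      by (rule l1_norm_linear_ge[OF block_subset \<open>0 < var\<close>])
    finally show ?thesis .
  qed
  have "(\<Sum>c\<in>C. l1_const * (?A c / (2 * sqrt b))) = l1_const * (\<Sum>e\<in>E. (a k e - a l e)\<^sup>2) / (2 * sqrt b)"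
    by (simp add: sum_blocks flip: sum_distrib_left sum_divide_distrib)
  moreover have "(\<Sum>c\<in>C. l1_const * (?A c / (2 * sqrt b)))
      \<le> (\<Sum>c\<in>C. \<integral>w. \<bar>\<Sum>e\<in>block c. (a k e - a l e) * w e\<bar> \<partial>\<mu>)"
    by (intro sum_mono le)
  ultimately have "l1_const * (\<Sum>e\<in>E. (a k e - a l e)\<^sup>2) / (2 * sqrt b)
      \<le> (\<Sum>c\<in>C. \<integral>w. \<bar>\<Sum>e\<in>block c. (a k e - a l e) * w e\<bar> \<partial>\<mu>)"
    by (simp only:)
  from divide_right_mono[OF this, of "4 * real (card C)"] show ?thesis
    by (simp add: gain_def)
qed

end

section \<open>Configurations of the Sherrington--Kirkpatrick model\<close>

text \<open>\<open>R\<close> is a graph of degree at most 1 on \<open>U\<close>. Keeping a point and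
  dropping its possible neighbour uses up at most two points for each one kept.\<close>

lemma half_independent_subset:
  assumes "finite U" "\<And>u v. R u v \<Longrightarrow> R v u"
    and "\<And>u. u \<in> U \<Longrightarrow> card {v \<in> U. v \<noteq> u \<and> R u v} \<le> 1"
  shows "\<exists>W\<subseteq>U. card U \<le> 2 * card W \<and> (\<forall>u\<in>W. \<forall>v\<in>W. u \<noteq> v \<longrightarrow> \<not> R u v)"
  using assms(1,3)
proof (induction U rule: finite_psubset_induct)
  case (psubset U)
  show ?case
  proof (cases "U = {}")
    case False
    then obtain u where u: "u \<in> U" by blast
    define Q where "Q = {v \<in> U. v \<noteq> u \<and> R u v}"
    define U' where "U' = U - insert u Q"
    have "card {w \<in> U'. w \<noteq> v \<and> R v w} \<le> 1" if "v \<in> U'" for v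
    proof -
      have "card {w \<in> U'. w \<noteq> v \<and> R v w} \<le> card {w \<in> U. w \<noteq> v \<and> R v w}"
        using psubset.hyps by (intro card_mono) (auto simp: U'_def)
      then show ?thesis using psubset.prems[of v] that by (auto simp: U'_def)
    qed
    moreover have "U' \<subset> U" using u by (auto simp: U'_def)
    ultimately obtain W where W: "W \<subseteq> U'" "card U' \<le> 2 * card W"
        "\<forall>u\<in>W. \<forall>v\<in>W. u \<noteq> v \<longrightarrow> \<not> R u v"
      using psubset.IH[of U'] by blast
    have finW: "finite W" using W(1) psubset.hyps finite_subset[of W U] by (auto simp: U'_def)
    have "U = insert u Q \<union> U'" using u by (auto simp: U'_def Q_def)
    then have "card U \<le> card (insert u Q) + card U'"
      by (metis card_Un_le)
    also have "card (insert u Q) \<le> 2"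
      using psubset.prems[OF u] psubset.hyps by (simp add: Q_def card_insert_if)
    also have "card U' \<le> 2 * card W" by (rule W(2))
    also have "2 + 2 * card W = 2 * card (insert u W)"
      using finW W(1) by (subst card_insert_disjoint) (auto simp: U'_def)
    finally have "card U \<le> 2 * card (insert u W)" by simp
    moreover have "\<forall>w\<in>insert u W. \<forall>v\<in>insert u W. w \<noteq> v \<longrightarrow> \<not> R w v"
      using W(1,3) assms(2) by (auto simp: U'_def Q_def)
    moreover have "insert u W \<subseteq> U" using u W(1) by (auto simp: U'_def)
    ultimately show ?thesis by blast
  qed simp
qed

definition sk_coeff :: "(nat \<Rightarrow> real) \<Rightarrow> nat \<times> nat \<Rightarrow> real" where
  "sk_coeff \<sigma> e = \<sigma> (fst e) * \<sigma> (snd e)"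

lemma finite_sk_edges: "finite (sk_edges n)"
  by (rule finite_subset[of _ "{1..n} \<times> {1..n}"]) (auto simp: sk_edges_def)

lemma card_sk_edges_le: "card (sk_edges n) \<le> n\<^sup>2"
proof -
  have "card (sk_edges n) \<le> card ({1..n} \<times> {1..n})"
    by (intro card_mono) (auto simp: sk_edges_def)
  then show ?thesis by (simp add: power2_eq_square)
qed

lemma sk_spins_subset: "sk_spins n \<subseteq> {1..n} \<rightarrow>\<^sub>E {1, -1}"
  by (auto simp: sk_spins_def)

lemma finite_sk_spins: "finite (sk_spins n)"
  by (rule finite_subset[OF sk_spins_subset]) (intro finite_PiE; simp)

lemma card_sk_spins_le: "card (sk_spins n) \<le> 2 ^ n"
proof -
  have "card (sk_spins n) \<le> card ({1..n} \<rightarrow>\<^sub>E {1, -1::real})"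
    by (intro card_mono sk_spins_subset finite_PiE) simp_all
  then show ?thesis by (simp add: card_PiE numeral_2_eq_2)
qed

lemma sk_spins_nonempty: "1 \<le> n \<Longrightarrow> sk_spins n \<noteq> {}"
proof -
  assume "1 \<le> n"
  then have "(\<lambda>i\<in>{1..n}. 1) \<in> sk_spins n" by (auto simp: sk_spins_def)
  then show ?thesis by blast
qed

lemma sk_spins_sign: "\<sigma> \<in> sk_spins n \<Longrightarrow> i \<in> {1..n} \<Longrightarrow> \<sigma> i = 1 \<or> \<sigma> i = -1"
  using PiE_mem[of \<sigma> "{1..n}" "\<lambda>_. {1, -1}" i] by (auto simp: sk_spins_def)

lemma sk_coeff_sign:
  assumes "\<sigma> \<in> sk_spins n" "e \<in> sk_edges n"
  shows "sk_coeff \<sigma> e \<in> {1, -1}"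
proof -
  have "fst e \<in> {1..n}" "snd e \<in> {1..n}" using assms(2) by (auto simp: sk_edges_def)
  then show ?thesis
    using sk_spins_sign[OF assms(1), of "fst e"] sk_spins_sign[OF assms(1), of "snd e"]
    by (auto simp: sk_coeff_def)
qed

text \<open>With the first spin fixed to 1, the edge \<open>(1, i)\<close> reads off spin
  \<open>i\<close>. A configuration and its negative would share all coefficients.\<close>

lemma sk_coeff_separated:
  assumes st: "\<sigma> \<in> sk_spins n" "\<tau> \<in> sk_spins n" "\<sigma> \<noteq> \<tau>"
  shows "\<exists>e\<in>sk_edges n. sk_coeff \<sigma> e \<noteq> sk_coeff \<tau> e"
proof -
  have "\<exists>i\<in>{1..n}. \<sigma> i \<noteq> \<tau> i"
  proof (rule ccontr)
    assume "\<not> (\<exists>i\<in>{1..n}. \<sigma> i \<noteq> \<tau> i)"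
    then have "\<sigma> = \<tau>"
      using PiE_ext[OF subsetD[OF sk_spins_subset st(1)] subsetD[OF sk_spins_subset st(2)]] by blast
    then show False using st(3) by simp
  qed
  then obtain i where i: "i \<in> {1..n}" "\<sigma> i \<noteq> \<tau> i" by blast
  have "\<sigma> 1 = 1" "\<tau> 1 = 1" using st by (auto simp: sk_spins_def)
  then have "i \<noteq> 1" using i by auto
  then have "(1, i) \<in> sk_edges n" using i(1) by (auto simp: sk_edges_def)
  moreover have "sk_coeff \<sigma> (1, i) \<noteq> sk_coeff \<tau> (1, i)"
    using i(2) \<open>\<sigma> 1 = 1\<close> \<open>\<tau> 1 = 1\<close> by (simp add: sk_coeff_def)
  ultimately show ?thesis by blast
qed

lemma sk_hamiltonian_eq: "sk_hamiltonian n x \<sigma> = - (\<Sum>e\<in>sk_edges n. sk_coeff \<sigma> e * x e)"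
  unfolding sk_hamiltonian_def sk_coeff_def
  by (intro arg_cong[where f = uminus] sum.cong) auto

lemma sk_block_subset: "i \<in> {1..n} \<Longrightarrow> sk_block n i \<subseteq> sk_edges n"
  by (auto simp: sk_block_def sk_edges_def)

lemma card_sk_block_containing:
  assumes "e \<in> sk_edges n"
  shows "card {i \<in> {1..n}. e \<in> sk_block n i} = 2"
proof -
  obtain i j where e: "e = (i, j)" "1 \<le> i" "i < j" "j \<le> n"
    using assms by (auto simp: sk_edges_def)
  then have "{k \<in> {1..n}. e \<in> sk_block n k} = {i, j}" by (auto simp: sk_block_def)
  then show ?thesis using e by simp
qed

lemma union_sk_block: "(\<Union>i\<in>{1..n}. sk_block n i) = sk_edges n"
proof
  show "sk_edges n \<subseteq> (\<Union>i\<in>{1..n}. sk_block n i)"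
  proof
    fix e assume "e \<in> sk_edges n"
    then have "fst e \<in> {1..n}" "e \<in> sk_block n (fst e)" by (auto simp: sk_edges_def sk_block_def)
    then show "e \<in> (\<Union>i\<in>{1..n}. sk_block n i)" by blast
  qed
qed (use sk_block_subset in blast)

text \<open>The coefficients of two configurations differ exactly on the edges of the cut between
  the sites where they agree and the sites where they disagree.\<close>

lemma sk_coeff_dist_ge:
  assumes st: "\<sigma> \<in> sk_spins n" "\<tau> \<in> sk_spins n"
  defines "A \<equiv> {i \<in> {1..n}. \<sigma> i \<noteq> \<tau> i}"
  shows "4 * (real (card A) * (real n - real (card A))) \<le> (\<Sum>e\<in>sk_edges n. (sk_coeff \<sigma> e - sk_coeff \<tau> e)\<^sup>2)"
proof -
  define B where "B = {1..n} - A"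
  \<comment> \<open>Edges carry the smaller site first; sorting is injective on the cut because
    \<open>A\<close> and \<open>B\<close> are disjoint.\<close>
  define \<phi> :: "nat \<times> nat \<Rightarrow> nat \<times> nat" where "\<phi> = (\<lambda>(i, j). (min i j, max i j))"
  have fin: "finite A" "finite B" by (auto simp: A_def B_def)
  have AB: "A \<inter> B = {}" "A \<subseteq> {1..n}" "B \<subseteq> {1..n}" by (auto simp: A_def B_def)
  have cB: "real (card B) = real n - real (card A)"
    unfolding B_def using AB(2) fin card_mono[OF _ AB(2)] by (simp add: card_Diff_subset of_nat_diff)
  have inj: "inj_on \<phi> (A \<times> B)"
    using AB(1) by (auto simp: inj_on_def \<phi>_def min_def max_def split: if_splits)
  have sub: "\<phi> ` (A \<times> B) \<subseteq> sk_edges n"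
  proof
    fix e assume "e \<in> \<phi> ` (A \<times> B)"
    then obtain i j where ij: "i \<in> A" "j \<in> B" "e = \<phi> (i, j)" by auto
    then have "i \<noteq> j" "i \<in> {1..n}" "j \<in> {1..n}" using AB by auto
    then show "e \<in> sk_edges n" by (auto simp: ij(3) \<phi>_def sk_edges_def min_def max_def)
  qed
  have val: "(sk_coeff \<sigma> (\<phi> z) - sk_coeff \<tau> (\<phi> z))\<^sup>2 = 4" if z: "z \<in> A \<times> B" for z
  proof -
    obtain i j where ij: "z = (i, j)" "i \<in> A" "j \<in> B" using z by auto
    then have mem: "i \<in> {1..n}" "j \<in> {1..n}" "\<sigma> i \<noteq> \<tau> i" "\<sigma> j = \<tau> j" by (auto simp: A_def B_def)
    have "sk_coeff s (\<phi> z) = s i * s j" for s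
      by (simp add: ij(1) \<phi>_def sk_coeff_def min_def max_def mult.commute)
    then show ?thesis
      using sk_spins_sign[OF st(1) mem(1)] sk_spins_sign[OF st(2) mem(1)] sk_spins_sign[OF st(2) mem(2)] mem(3,4)
      by auto
  qed
  have "4 * (real (card A) * real (card B)) = (\<Sum>z\<in>A \<times> B. (sk_coeff \<sigma> (\<phi> z) - sk_coeff \<tau> (\<phi> z))\<^sup>2)"
    by (simp add: val card_cartesian_product)
  also have "\<dots> = (\<Sum>e\<in>\<phi> ` (A \<times> B). (sk_coeff \<sigma> e - sk_coeff \<tau> e)\<^sup>2)"
    by (simp add: sum.reindex[OF inj])
  also have "\<dots> \<le> (\<Sum>e\<in>sk_edges n. (sk_coeff \<sigma> e - sk_coeff \<tau> e)\<^sup>2)"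
    by (intro sum_mono2 finite_sk_edges sub) auto
  finally show ?thesis by (simp add: cB)
qed

lemma sk_metric_sym: "sk_metric n \<sigma> \<tau> = sk_metric n \<tau> \<sigma>"
  unfolding sk_metric_def by (intro arg_cong2[where f = "(/)"] arg_cong[where f = real] arg_cong[where f = card]) auto

text \<open>Two configurations that are both nearly antipodal to a third one are close to each other;
  so dropping at most half of the points of a packing removes all nearly antipodal pairs.\<close>

lemma sk_packing_without_antipodes:
  assumes n: "1 \<le> n" and U: "U \<subseteq> sk_spins n" "pairwise (\<lambda>\<sigma> \<tau>. \<epsilon> < sk_metric n \<sigma> \<tau>) U"
  shows "\<exists>W\<subseteq>U. card U \<le> 2 * card W \<and>
    (\<forall>\<sigma>\<in>W. \<forall>\<tau>\<in>W. \<sigma> \<noteq> \<tau> \<longrightarrow> \<epsilon> < sk_metric n \<sigma> \<tau> \<and> sk_metric n \<sigma> \<tau> \<le> 1 - \<epsilon> / 2)"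
proof -
  have finU: "finite U" using U(1) finite_sk_spins finite_subset by blast
  let ?R = "\<lambda>\<sigma> \<tau>. 1 - \<epsilon> / 2 < sk_metric n \<sigma> \<tau>"
  have close: "sk_metric n v v' \<le> \<epsilon>" if "u \<in> U" "v \<in> U" "v' \<in> U" "?R u v" "?R u v'" for u v v'
  proof -
    let ?D = "\<lambda>s t. {i \<in> {1..n}. s i \<noteq> t i}"
    have card_eq: "real (card ({1..n} - ?D s t)) = real n - real (card (?D s t))" for s t :: "nat \<Rightarrow> real"
    proof -
      have "card (?D s t) \<le> card {1..n}" by (intro card_mono) auto
      then show ?thesis by (subst card_Diff_subset) (auto simp: of_nat_diff)
    qed
    \<comment> \<open>Spins have two values, so where \<open>v\<close> and \<open>v'\<close> differ,
      one of them agrees with \<open>u\<close>.\<close>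
    have "i \<in> ({1..n} - ?D u v) \<union> ({1..n} - ?D u v')" if "i \<in> ?D v v'" for i
    proof -
      have i: "i \<in> {1..n}" "v i \<noteq> v' i" using that by auto
      have "w i = 1 \<or> w i = -1" if "w \<in> U" for w
        using sk_spins_sign[OF _ i(1)] that U(1) by blast
      from this[OF \<open>u \<in> U\<close>] this[OF \<open>v \<in> U\<close>] this[OF \<open>v' \<in> U\<close>] show ?thesis using i by auto
    qed
    then have "?D v v' \<subseteq> ({1..n} - ?D u v) \<union> ({1..n} - ?D u v')" by blast
    then have "card (?D v v') \<le> card (({1..n} - ?D u v) \<union> ({1..n} - ?D u v'))"
      by (intro card_mono) auto
    also have "\<dots> \<le> card ({1..n} - ?D u v) + card ({1..n} - ?D u v')" by (rule card_Un_le)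
    finally have "real (card (?D v v')) \<le> real (card ({1..n} - ?D u v)) + real (card ({1..n} - ?D u v'))"
      by linarith
    then have "real (card (?D v v')) \<le> (real n - real (card (?D u v))) + (real n - real (card (?D u v')))"
      by (simp only: card_eq)
    moreover have "(1 - \<epsilon> / 2) * n < card (?D u v)" "(1 - \<epsilon> / 2) * n < card (?D u v')"
      using that(4,5) n by (simp_all add: sk_metric_def field_simps)
    ultimately have "real (card (?D v v')) \<le> \<epsilon> * n" by (simp add: algebra_simps)
    then show ?thesis using n by (simp add: sk_metric_def field_simps)
  qed
  have "\<exists>W\<subseteq>U. card U \<le> 2 * card W \<and> (\<forall>u\<in>W. \<forall>v\<in>W. u \<noteq> v \<longrightarrow> \<not> ?R u v)"
  proof (rule half_independent_subset[OF finU])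
    fix u assume u: "u \<in> U"
    have "v = v'" if "v \<in> {v \<in> U. v \<noteq> u \<and> ?R u v}" "v' \<in> {v \<in> U. v \<noteq> u \<and> ?R u v}" for v v'
      using close[of u v v'] that u U(2) by (force simp: pairwise_def)
    then show "card {v \<in> U. v \<noteq> u \<and> ?R u v} \<le> 1"
      using finU by (intro card_le_Suc0_iff_eq[THEN iffD2, folded One_nat_def]) auto
  qed (simp add: sk_metric_sym)
  then show ?thesis using U(2) unfolding pairwise_def by (meson not_less subsetD)
qed

section \<open>Instability at finite size\<close>

locale sk_model = centred_inputs P "sk_edges n" for P :: "real measure" and n :: nat +
  assumes n_pos: "1 \<le> n"
begin

sublocale linear_optimization P "sk_edges n" "sk_spins n" sk_coeff
  by unfold_locales (use finite_sk_spins sk_spins_nonempty[OF n_pos] in auto)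

text \<open>At \<open>\<theta> = 1 / sqrt n\<close> the entropy term and the at most
  \<open>n\<^sup>2\<close> edges, each with exponent \<open>v / n\<close>, are both of order
  \<open>n\<close>. The condition on \<open>c\<close> gives \<open>c * \<theta> \<le> 1 / 2\<close>,
  which keeps the sub-Gamma denominator at least 1.\<close>

lemma integral_opt_bound:
  assumes sg: "sub_gamma P (\<lambda>t. t) v c" and c: "2 * c \<le> sqrt n"
  shows "(\<integral>x. opt x \<partial>\<mu>) \<le> (2 + v) * (n * sqrt n)"
proof -
  define \<theta> where "\<theta> = 1 / sqrt n"
  have sn: "0 < sqrt n" using n_pos by simp
  have \<theta>: "0 < \<theta>" "\<theta>\<^sup>2 = 1 / n" using n_pos by (simp_all add: \<theta>_def power_divide)
  have vc: "0 \<le> v" "0 \<le> c" using sg by (auto simp: sub_gamma_def)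
  have c\<theta>: "c * \<theta> \<le> 1 / 2" using c sn by (simp add: \<theta>_def field_simps)
  have cond: "c = 0 \<or> \<theta> < 1 / c"
  proof (cases "c = 0")
    case False
    then have "\<theta> * c < 1" using c\<theta> by (simp add: mult.commute)
    then show ?thesis using vc False by (simp add: field_simps)
  qed simp
  have mgf: "integrable P (\<lambda>x. exp (t * x)) \<and> (\<integral>x. exp (t * x) \<partial>P) \<le> exp (v / n)" if t: "\<bar>t\<bar> = \<theta>" for t
  proof -
    let ?I = "\<integral>x. exp (t * x) \<partial>P"
    have "t\<^sup>2 = 1 / n" using t \<theta>(2) by (metis power2_abs)
    have I: "integrable P (\<lambda>x. exp (t * x))" "ln ?I \<le> t\<^sup>2 * v / (2 * (1 - c * \<bar>t\<bar>))"
      using sg cond t unfolding sub_gamma_def by (auto simp: mean_0)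
    have "t\<^sup>2 * v / (2 * (1 - c * \<bar>t\<bar>)) \<le> t\<^sup>2 * v / 1"
      using vc c\<theta> t by (intro divide_left_mono) auto
    then have le: "ln ?I \<le> v / n" using I(2) \<open>t\<^sup>2 = 1 / n\<close> by simp
    have "?I \<le> exp (v / n)"
    proof (cases "0 < ?I")
      case True
      then show ?thesis using le by (metis exp_le_cancel_iff exp_ln)
    next
      case False
      then show ?thesis by (meson exp_ge_zero not_le order_trans)
    qed
    with I(1) show ?thesis by simp
  qed
  have "(\<integral>x. opt x \<partial>\<mu>) \<le> (ln (card (sk_spins n)) + card (sk_edges n) * (v / n) + 1) / \<theta>"
    by (rule integral_opt_le[OF sk_coeff_sign \<theta>(1)]) (use mgf[of \<theta>] mgf[of "- \<theta>"] \<theta> in auto)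
  also have "\<dots> \<le> (real n + real n * v + real n) / \<theta>"
  proof (intro divide_right_mono add_mono)
    have pos: "0 < real (card (sk_spins n))"
      using finite_S S_nonempty by (simp add: card_gt_0_iff)
    have "real (card (sk_spins n)) \<le> 2 ^ n"
      using card_sk_spins_le[of n] by (metis of_nat_le_iff of_nat_numeral of_nat_power)
    then have "ln (card (sk_spins n)) \<le> ln (2 ^ n :: real)"
      using pos by simp
    also have "\<dots> \<le> real n" using ln_2_less_1 by (simp add: ln_realpow mult_left_le)
    finally show "ln (card (sk_spins n)) \<le> real n" .
    have "real (card (sk_edges n)) \<le> real n * real n"
      using card_sk_edges_le[of n] by (metis of_nat_le_iff of_nat_mult power2_eq_square)
    then have "real (card (sk_edges n)) * (v / n) \<le> (real n * real n) * (v / n)"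
      using vc by (intro mult_right_mono) auto
    then show "real (card (sk_edges n)) * (v / n) \<le> real n * v" using n_pos by simp
  qed (use n_pos \<theta> in auto)
  also have "\<dots> = (2 + v) * (n * sqrt n)" by (simp add: \<theta>_def algebra_simps)
  finally show ?thesis .
qed

end

section \<open>Blocks of couplings and the estimate at finite size\<close>

locale sk_blocks = sk_model P n for P :: "real measure" and n :: nat +
  fixes L :: nat
  assumes L: "0 < L" "L \<le> n"
begin

text \<open>Each row of the upper triangle is cut by the residue of the column modulo
  \<open>L\<close>. This gives \<open>n * L\<close> blocks, possibly empty, of at most
  \<open>2 * n / L\<close> couplings.\<close>

sublocale block_optimization P "sk_edges n" "sk_spins n" sk_coeff "{1..n} \<times> {..<L}" "\<lambda>(i, j). (i, j mod L)"
proof unfold_locales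
  show "{1..n} \<times> {..<L} \<noteq> {}" using n_pos L by auto
  show "(\<lambda>(i, j). (i, j mod L)) ` sk_edges n \<subseteq> {1..n} \<times> {..<L}"
    using L by (auto simp: sk_edges_def)
qed simp

text \<open>Row and residue are fixed in a block, so the quotient of the column by \<open>L\<close>
  determines the edge; \<open>L \<le> n\<close> absorbs the extra 1.\<close>

lemma card_block_le: "real (card (block c)) \<le> 2 * n / L"
proof -
  define f where "f = (\<lambda>e :: nat \<times> nat. snd e div L)"
  have "inj_on f (block c)"
    by (rule inj_onI) (auto simp: f_def block_def; metis mod_div_mult_eq)
  moreover have "f ` block c \<subseteq> {..n div L}"
  proof
    fix m assume "m \<in> f ` block c"
    then obtain e where e: "e \<in> sk_edges n" "m = snd e div L"
      using block_subset[of c] by (auto simp: f_def)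
    then have "snd e \<le> n" by (auto simp: sk_edges_def)
    then show "m \<in> {..n div L}" using e(2) by (simp add: div_le_mono)
  qed
  ultimately have "card (block c) \<le> n div L + 1"
    using card_inj_on_le[of f "block c" "{..n div L}"] by simp
  then have "real (card (block c)) \<le> real (n div L) + 1" by linarith
  also have "\<dots> \<le> n / L + n / L"
    using L by (intro add_mono of_nat_div_le_of_nat) auto
  finally show ?thesis by simp
qed

text \<open>Both bounds on the distance are needed to make the cut \<open>?D * (n - ?D)\<close> at
  least \<open>\<epsilon>\<^sup>2 * n\<^sup>2 / 2\<close>. The 32 results from
  \<open>gain_ge\<close> with \<open>n * L\<close> blocks of size at most
  \<open>2 * n / L\<close>.\<close>

lemma gain_separated_ge:
  assumes v: "0 < var" and "0 < \<epsilon>" and st: "\<sigma> \<in> sk_spins n" "\<tau> \<in> sk_spins n"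
    and d: "\<epsilon> < sk_metric n \<sigma> \<tau>" "sk_metric n \<sigma> \<tau> \<le> 1 - \<epsilon> / 2"
  shows "l1_const * \<epsilon>\<^sup>2 * sqrt (n / (32 * L)) \<le> gain \<sigma> \<tau>"
proof -
  let ?D = "real (card {i \<in> {1..n}. \<sigma> i \<noteq> \<tau> i})"
  have n0: "0 < real n" and L0: "0 < real L" using n_pos L by auto
  have D: "\<epsilon> * n \<le> ?D" "\<epsilon> / 2 * n \<le> n - ?D"
    using d n0 by (simp_all add: sk_metric_def field_simps)
  have "2 * \<epsilon>\<^sup>2 * n\<^sup>2 = 4 * ((\<epsilon> * n) * (\<epsilon> / 2 * n))" by (simp add: power2_eq_square)
  also have "\<dots> \<le> 4 * (?D * (n - ?D))"
    using D \<open>0 < \<epsilon>\<close> n0 by (intro mult_left_mono mult_mono) auto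
  also have "\<dots> \<le> (\<Sum>e\<in>sk_edges n. (sk_coeff \<sigma> e - sk_coeff \<tau> e)\<^sup>2)"
    by (rule sk_coeff_dist_ge[OF st])
  finally have sum: "2 * \<epsilon>\<^sup>2 * n\<^sup>2 \<le> (\<Sum>e\<in>sk_edges n. (sk_coeff \<sigma> e - sk_coeff \<tau> e)\<^sup>2)" .
  define b where "b = 2 * n / L"
  have "0 < b" unfolding b_def using n0 L0 by simp
  have sq: "sqrt b * sqrt (n / (32 * L)) = n / (4 * L)"
  proof -
    have "sqrt b * sqrt (n / (32 * L)) = sqrt ((n / (4 * L))\<^sup>2)"
      unfolding real_sqrt_mult[symmetric] b_def using L0 by (intro arg_cong[where f = sqrt]) (simp add: power2_eq_square field_simps)
    then show ?thesis using n0 L0 by (simp only: real_sqrt_abs) simp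
  qed
  have "l1_const * \<epsilon>\<^sup>2 * sqrt (n / (32 * L)) = l1_const * (2 * \<epsilon>\<^sup>2 * n\<^sup>2) / (8 * sqrt b * card ({1..n} \<times> {..<L}))"
  proof -
    have "sqrt (n / (32 * L)) = n / (4 * L) / sqrt b"
      unfolding sq[symmetric] using \<open>0 < b\<close> by (subst nonzero_mult_div_cancel_left) auto
    then show ?thesis using n0 L0 \<open>0 < b\<close> by (simp add: field_simps power2_eq_square)
  qed
  also have "\<dots> \<le> l1_const * (\<Sum>e\<in>sk_edges n. (sk_coeff \<sigma> e - sk_coeff \<tau> e)\<^sup>2) / (8 * sqrt b * card ({1..n} \<times> {..<L}))"
    using sum l1_const_nonneg \<open>0 < b\<close> by (intro divide_right_mono mult_left_mono) auto
  also have "\<dots> \<le> gain \<sigma> \<tau>"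
  proof (rule gain_ge[OF v \<open>0 < b\<close>])
    show "real (card (block c)) \<le> b" for c unfolding b_def by (rule card_block_le)
    show "(sk_coeff \<sigma> e - sk_coeff \<tau> e)\<^sup>2 \<le> 4" if "e \<in> sk_edges n" for e
      using sk_coeff_sign[OF st(1) that] sk_coeff_sign[OF st(2) that] by auto
  qed
  finally show ?thesis .
qed

text \<open>Almost surely, the bad event forces either a total regret of at least
  \<open>\<epsilon> * n * \<kappa>\<close>, controlled by Markov's inequality, or
  \<open>2 ^ T\<close> separated near-optima of the unperturbed input.\<close>

lemma instability_bound:
  fixes M :: "'w measure" and x :: "'w \<Rightarrow> nat \<times> nat \<Rightarrow> real" and y :: "nat \<Rightarrow> 'w \<Rightarrow> nat \<times> nat \<Rightarrow> real"
    and \<epsilon> \<kappa> :: real and T :: nat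
  assumes M: "prob_space M" and v: "0 < var" and atomless: "\<And>c. AE t in P. t \<noteq> c"
    and mx: "x \<in> measurable M \<mu>" and law_x: "distr M \<mu> x = \<mu>"
    and my: "\<And>i. i \<in> {1..n} \<Longrightarrow> y i \<in> measurable M \<mu>"
    and law: "\<And>i. i \<in> {1..n} \<Longrightarrow> distr M (\<mu> \<Otimes>\<^sub>M \<mu>) (\<lambda>\<omega>. (x \<omega>, y i \<omega>)) = \<mu> \<Otimes>\<^sub>M \<mu>"
    and "0 < \<epsilon>" "0 < \<kappa>"
  shows "measure M {\<omega> \<in> space M.
      enat (Suc (2 ^ Suc T)) \<le> (INF A \<in> {A. A \<subseteq> {1..n} \<and> real (card A) > (1 - \<epsilon>) * real (card {1..n})}.
        packing_number ((\<lambda>i. arg_min_on (sk_hamiltonian n (resample (sk_block n i) (x \<omega>) (y i \<omega>))) (sk_spins n)) ` A)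
          (sk_metric n) \<epsilon>)}
    \<le> 4 * (\<integral>x. opt x \<partial>\<mu>) / (\<epsilon> * n * \<kappa>)
      + measure \<mu> (spread_near_optima T (l1_const * \<epsilon>\<^sup>2 * sqrt (n / (32 * L))) \<kappa>)"
    (is "measure M ?Bad \<le> ?r1 + measure \<mu> ?G")
proof -
  interpret M: prob_space M by (rule M)
  let ?z = "\<lambda>i \<omega>. resample (sk_block n i) (x \<omega>) (y i \<omega>)"
  let ?s = "\<lambda>i \<omega>. arg_min_on (sk_hamiltonian n (?z i \<omega>)) (sk_spins n)"
  let ?reg = "\<lambda>i \<omega>. regret (sk_block n i) (x \<omega>) (y i \<omega>)"
  define \<Gamma> where "\<Gamma> = (\<lambda>\<omega>. \<Sum>i\<in>{1..n}. ?reg i \<omega>)"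
  have mxy: "(\<lambda>\<omega>. (x \<omega>, y i \<omega>)) \<in> measurable M (\<mu> \<Otimes>\<^sub>M \<mu>)" if "i \<in> {1..n}" for i
    using mx my[OF that] by (rule measurable_Pair)
  have ireg: "integrable M (?reg i)" and Ereg: "(\<integral>\<omega>. ?reg i \<omega> \<partial>M) \<le> 2 * (\<integral>x. block_value (sk_block n i) x \<partial>\<mu>)"
    if i: "i \<in> {1..n}" for i
  proof -
    have reg: "integrable (distr M (\<mu> \<Otimes>\<^sub>M \<mu>) (\<lambda>\<omega>. (x \<omega>, y i \<omega>))) (\<lambda>z. regret (sk_block n i) (fst z) (snd z))"
      unfolding law[OF i] by (rule integrable_regret)
    show "integrable M (?reg i)" using integrable_distr[OF mxy[OF i] reg] by simp
    have "(\<integral>\<omega>. ?reg i \<omega> \<partial>M) = (\<integral>z. regret (sk_block n i) (fst z) (snd z) \<partial>(distr M (\<mu> \<Otimes>\<^sub>M \<mu>) (\<lambda>\<omega>. (x \<omega>, y i \<omega>))))"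
      using integral_distr[OF mxy[OF i] borel_measurable_integrable[OF integrable_regret], of "sk_block n i"] by simp
    also have "\<dots> \<le> 2 * (\<integral>x. block_value (sk_block n i) x \<partial>\<mu>)"
      unfolding law[OF i] by (rule integral_regret_le[OF sk_block_subset[OF i]])
    finally show "(\<integral>\<omega>. ?reg i \<omega> \<partial>M) \<le> 2 * (\<integral>x. block_value (sk_block n i) x \<partial>\<mu>)" .
  qed
  have i\<Gamma>: "integrable M \<Gamma>" unfolding \<Gamma>_def by (intro Bochner_Integration.integrable_sum ireg)
  have "(\<integral>\<omega>. \<Gamma> \<omega> \<partial>M) = (\<Sum>i\<in>{1..n}. \<integral>\<omega>. ?reg i \<omega> \<partial>M)"
    unfolding \<Gamma>_def by (intro Bochner_Integration.integral_sum ireg)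
  also have "\<dots> \<le> (\<Sum>i\<in>{1..n}. 2 * (\<integral>x. block_value (sk_block n i) x \<partial>\<mu>))"
    by (intro sum_mono Ereg)
  also have "\<dots> = 2 * (\<integral>x. (\<Sum>i\<in>{1..n}. block_value (sk_block n i) x) \<partial>\<mu>)"
    unfolding sum_distrib_left[symmetric]
    by (intro arg_cong[where f = "(*) 2"] Bochner_Integration.integral_sum[symmetric]
        integrable_lin_bounded lin_bounded_block_value sk_block_subset)
  \<comment> \<open>One factor 2 comes from \<open>integral_regret_le\<close>, the other from the
    two blocks through each coupling.\<close>
  also have "\<dots> = 4 * (\<integral>x. opt x \<partial>\<mu>)"
    by (subst sum_block_value[OF finite_atLeastAtMost sk_block_subset card_sk_block_containing]) simp_all
  finally have E\<Gamma>: "(\<integral>\<omega>. \<Gamma> \<omega> \<partial>M) \<le> 4 * (\<integral>x. opt x \<partial>\<mu>)" .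
  have n0: "0 < real n" using n_pos by simp
  let ?B1 = "{\<omega> \<in> space M. \<epsilon> * n * \<kappa> \<le> \<Gamma> \<omega>}" and ?B2 = "x -` ?G \<inter> space M"
  have B1: "?B1 \<in> sets M" using borel_measurable_integrable[OF i\<Gamma>] by measurable
  have B2: "?B2 \<in> sets M" by (rule measurable_sets[OF mx sets_spread_near_optima])
  have \<Gamma>0: "0 \<le> \<Gamma> \<omega>" for \<omega> unfolding \<Gamma>_def by (intro sum_nonneg regret_nonneg)
  have "measure M ?B1 \<le> (\<integral>\<omega>. \<Gamma> \<omega> \<partial>M) / (\<epsilon> * n * \<kappa>)"
    by (rule integral_Markov_inequality_measure[OF i\<Gamma> sets.empty_sets])
      (use \<Gamma>0 \<open>0 < \<epsilon>\<close> \<open>0 < \<kappa>\<close> n0 in auto)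
  also have "\<dots> \<le> ?r1"
    using E\<Gamma> \<open>0 < \<epsilon>\<close> \<open>0 < \<kappa>\<close> n0 by (intro divide_right_mono) auto
  finally have P1: "measure M ?B1 \<le> ?r1" .
  have P2: "measure M ?B2 = measure \<mu> ?G"
    using measure_distr[OF mx sets_spread_near_optima] unfolding law_x by simp
  let ?uniq = "\<lambda>z. \<forall>s\<in>sk_spins n. \<forall>t\<in>sk_spins n. dot s z = opt z \<longrightarrow> dot t z = opt z \<longrightarrow> s = t"
  have "AE \<omega> in M. ?uniq (?z i \<omega>)" if i: "i \<in> {1..n}" for i
  proof -
    have "AE z in \<mu>. ?uniq z" by (rule AE_unique_optimizer[OF atomless sk_coeff_separated])
    then have "AE z in distr (\<mu> \<Otimes>\<^sub>M \<mu>) \<mu> (\<lambda>(x, w). resample (sk_block n i) x w). ?uniq z"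
      unfolding distr_resample .
    then have "AE p in \<mu> \<Otimes>\<^sub>M \<mu>. ?uniq (resample (sk_block n i) (fst p) (snd p))"
      using AE_distrD[OF measurable_resample_pair] by (simp add: split_beta')
    then have "AE p in distr M (\<mu> \<Otimes>\<^sub>M \<mu>) (\<lambda>\<omega>. (x \<omega>, y i \<omega>)). ?uniq (resample (sk_block n i) (fst p) (snd p))"
      unfolding law[OF i] .
    then show ?thesis using AE_distrD[OF mxy[OF i]] by fastforce
  qed
  then have uniq: "AE \<omega> in M. \<forall>i\<in>{1..n}. ?uniq (?z i \<omega>)"
    by (rule AE_finite_allI[OF finite_atLeastAtMost])
  have incl: "\<omega> \<in> ?B1 \<union> ?B2" if u: "\<forall>i\<in>{1..n}. ?uniq (?z i \<omega>)" and bad: "\<omega> \<in> ?Bad" for \<omega>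
  proof (rule ccontr)
    assume notin: "\<omega> \<notin> ?B1 \<union> ?B2"
    have \<omega>: "\<omega> \<in> space M" using bad by simp
    have small: "\<Gamma> \<omega> < \<epsilon> * n * \<kappa>" using notin \<omega> by auto
    have s_opt: "?s i \<omega> \<in> sk_spins n \<and> dot (?s i \<omega>) (?z i \<omega>) = opt (?z i \<omega>)" for i
    proof -
      have ham: "sk_hamiltonian n z s = - dot s z" for z s
        by (simp add: sk_hamiltonian_eq dot_def)
      have am: "?s i \<omega> \<in> sk_spins n" "\<not> (\<exists>t\<in>sk_spins n. sk_hamiltonian n (?z i \<omega>) t < sk_hamiltonian n (?z i \<omega>) (?s i \<omega>))"
        using arg_min_if_finite[OF finite_S S_nonempty, of "sk_hamiltonian n (?z i \<omega>)"] by auto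
      obtain t where t: "t \<in> sk_spins n" "dot t (?z i \<omega>) = opt (?z i \<omega>)" by (rule opt_attained)
      then have "opt (?z i \<omega>) \<le> dot (?s i \<omega>) (?z i \<omega>)" using am(2) by (force simp: ham)
      then show ?thesis using am(1) dot_le_opt[OF am(1), of "?z i \<omega>"] by simp
    qed
    have reg: "?reg i \<omega> = opt (x \<omega>) - dot (?s i \<omega>) (x \<omega>)" if "i \<in> {1..n}" for i
      using regret_unique[of "sk_block n i" "x \<omega>" "y i \<omega>" "?s i \<omega>"] u that s_opt[of i] by blast
    \<comment> \<open>Every index outside \<open>A\<close> adds more than \<open>\<kappa>\<close> to
      \<open>\<Gamma> \<omega>\<close>, so fewer than \<open>\<epsilon> * n\<close> are outside and
      \<open>A\<close> is admissible in the infimum.\<close>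
    define A where "A = {i \<in> {1..n}. ?reg i \<omega> \<le> \<kappa>}"
    have "(1 - \<epsilon>) * real n < real (card A)"
    proof (rule ccontr)
      assume neg: "\<not> (1 - \<epsilon>) * real n < real (card A)"
      have "real (card ({1..n} - A)) = n - real (card A)"
      proof -
        have "A \<subseteq> {1..n}" by (auto simp: A_def)
        moreover from this have "card A \<le> n" using card_mono[of "{1..n}" A] by simp
        ultimately show ?thesis by (subst card_Diff_subset) (auto simp: of_nat_diff intro: finite_subset)
      qed
      then have "\<epsilon> * real n \<le> real (card ({1..n} - A))" using neg by (simp add: algebra_simps)
      then have "\<epsilon> * real n * \<kappa> \<le> real (card ({1..n} - A)) * \<kappa>" using \<open>0 < \<kappa>\<close> by simp
      also have "\<dots> = (\<Sum>i\<in>{1..n} - A. \<kappa>)" by simp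
      also have "\<dots> \<le> (\<Sum>i\<in>{1..n} - A. ?reg i \<omega>)" by (intro sum_mono) (auto simp: A_def)
      also have "\<dots> \<le> \<Gamma> \<omega>" unfolding \<Gamma>_def by (intro sum_mono2) (auto simp: regret_nonneg)
      finally show False using small by simp
    qed
    then have A: "A \<in> {A. A \<subseteq> {1..n} \<and> real (card A) > (1 - \<epsilon>) * real (card {1..n})}"
      by (auto simp: A_def)
    have "enat (Suc (2 ^ Suc T)) \<le> packing_number ((\<lambda>i. ?s i \<omega>) ` A) (sk_metric n) \<epsilon>"
      using bad INF_lower[OF A] by (auto intro: order_trans)
    \<comment> \<open>The successor in the threshold makes this strict, so the supremum yields an
      actual packing.\<close>
    then have "enat (2 ^ Suc T) < packing_number ((\<lambda>i. ?s i \<omega>) ` A) (sk_metric n) \<epsilon>"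
      using less_le_trans[of "enat (2 ^ Suc T)" "enat (Suc (2 ^ Suc T))"] by simp
    then obtain U where U: "U \<subseteq> (\<lambda>i. ?s i \<omega>) ` A" "pairwise (\<lambda>\<sigma> \<tau>. \<epsilon> < sk_metric n \<sigma> \<tau>) U" "2 ^ Suc T < card U"
      unfolding packing_number_def less_SUP_iff by auto
    have US: "U \<subseteq> sk_spins n" using U(1) s_opt by auto
    obtain W where W: "W \<subseteq> U" "card U \<le> 2 * card W"
      "\<forall>\<sigma>\<in>W. \<forall>\<tau>\<in>W. \<sigma> \<noteq> \<tau> \<longrightarrow> \<epsilon> < sk_metric n \<sigma> \<tau> \<and> sk_metric n \<sigma> \<tau> \<le> 1 - \<epsilon> / 2"
      using sk_packing_without_antipodes[OF n_pos US U(2)] by blast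
    have "2 ^ T \<le> card W" using W(2) U(3) by simp
    then obtain V where V: "V \<subseteq> W" "card V = 2 ^ T" by (rule obtain_subset_with_card_n)
    have "opt (x \<omega>) - \<kappa> \<le> dot s (x \<omega>)" if s: "s \<in> V" for s
    proof -
      obtain i where i: "i \<in> A" "s = ?s i \<omega>" using s V(1) W(1) U(1) by blast
      then have "?reg i \<omega> \<le> \<kappa>" "i \<in> {1..n}" by (auto simp: A_def)
      then show ?thesis using reg[of i] i(2) by simp
    qed
    moreover have "l1_const * \<epsilon>\<^sup>2 * sqrt (n / (32 * L)) \<le> gain s t" if "s \<in> V" "t \<in> V" "s \<noteq> t" for s t
      using gain_separated_ge[OF v \<open>0 < \<epsilon>\<close>, of s t] that V(1) W(1,3) US by blast
    ultimately have "x \<omega> \<in> ?G"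
      unfolding spread_near_optima_def using V W(1) US measurable_space[OF mx \<omega>] by blast
    then show False using notin \<omega> by simp
  qed
  \<comment> \<open>Measurability is required of the covering events only; \<open>?Bad\<close>
    involves an arbitrary selection of minimizers.\<close>
  have "measure M ?Bad \<le> measure M (?B1 \<union> ?B2)"
  proof (rule M.finite_measure_mono_AE)
    show "AE \<omega> in M. \<omega> \<in> ?Bad \<longrightarrow> \<omega> \<in> ?B1 \<union> ?B2"
      using uniq by (rule AE_mp) (intro AE_I2 impI, erule incl, assumption)
  qed (use B1 B2 in auto)
  also have "\<dots> \<le> measure M ?B1 + measure M ?B2"
    by (rule measure_Un_le[OF B1 B2])
  finally show ?thesis using P1 P2 by simp
qed

end

section \<open>Stability of the sequence\<close>

text \<open>The inequality \<open>u \<le> exp u\<close> at a quarter of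
  \<open>r * \<bar>t\<bar>\<close>, raised to the fourth power. This \<open>r\<close> lies in the
  admissible range for \<open>c = 0\<close> as well.\<close>

lemma sub_gamma_integrable_power4:
  assumes "sets P = sets borel" and sg: "sub_gamma P (\<lambda>t. t) v c" and mean: "(\<integral>t. t \<partial>P) = 0"
  shows "integrable P (\<lambda>t. t ^ 4)"
proof -
  define r where "r = 1 / (2 * (c + 1))"
  have c: "0 \<le> c" using sg by (simp add: sub_gamma_def)
  then have r: "0 < r" by (simp add: r_def)
  have cond: "c = 0 \<or> r < 1 / c"
  proof (cases "c = 0")
    case False
    then show ?thesis unfolding r_def using c by (intro disjI2 divide_strict_left_mono) auto
  qed simp
  have "integrable P (\<lambda>t. exp (s * t))" if "\<bar>s\<bar> = r" for s
    using sg cond that unfolding sub_gamma_def mean by auto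
  from this[of r] this[of "- r"] r have "integrable P (\<lambda>t. exp (r * t))" "integrable P (\<lambda>t. exp (- r * t))"
    by simp_all
  then have "integrable P (\<lambda>t. (4 / r) ^ 4 * (exp (r * t) + exp (- r * t)))"
    by (intro integrable_mult_right Bochner_Integration.integrable_add)
  then show ?thesis
  proof (rule Bochner_Integration.integrable_bound)
    show "(\<lambda>t. t ^ 4) \<in> borel_measurable P"
      by (simp add: measurable_cong_sets[OF assms(1) refl])
    show "AE t in P. norm (t ^ 4) \<le> norm ((4 / r) ^ 4 * (exp (r * t) + exp (- r * t)))"
    proof (rule AE_I2)
      fix t
      have "r * \<bar>t\<bar> / 4 \<le> exp (r * \<bar>t\<bar> / 4)"
        using exp_ge_add_one_self[of "r * \<bar>t\<bar> / 4"] by linarith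
      then have "(r * \<bar>t\<bar> / 4) ^ 4 \<le> exp (r * \<bar>t\<bar> / 4) ^ 4"
        using r by (intro power_mono) auto
      also have "\<dots> = exp (r * \<bar>t\<bar>)" by (simp flip: exp_of_nat_mult)
      also have "\<dots> \<le> exp (r * t) + exp (- r * t)"
        by (cases "0 \<le> t") auto
      finally have "(4 / r) ^ 4 * (r * \<bar>t\<bar> / 4) ^ 4 \<le> (4 / r) ^ 4 * (exp (r * t) + exp (- r * t))"
        using r by (intro mult_left_mono) auto
      moreover have "(4 / r) ^ 4 * (r * \<bar>t\<bar> / 4) ^ 4 = \<bar>t\<bar> ^ 4"
        using r by (simp flip: power_mult_distrib)
      ultimately show "norm (t ^ 4) \<le> norm ((4 / r) ^ 4 * (exp (r * t) + exp (- r * t)))"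
        by (simp add: power_abs)
    qed
  qed
qed

lemma (in centred_inputs) var_pos:
  assumes "AE t in P. t \<noteq> 0"
  shows "0 < var"
proof (rule ccontr)
  assume "\<not> 0 < var"
  then have "(\<integral>t. t\<^sup>2 \<partial>P) = 0" using var_nonneg unfolding var_def by linarith
  then have "AE t in P. t\<^sup>2 = 0"
    using integral_nonneg_eq_0_iff_AE[OF integrable_power[of 2]] by simp
  with assms have "AE t in P. False" by eventually_elim simp
  then show False by simp
qed

lemma AE_density_lborel_not_point:
  assumes "f \<in> borel_measurable borel"
  shows "AE t in density lborel (\<lambda>x. ennreal (f x)). t \<noteq> c"
  using assms AE_lborel_singleton[of c] by (subst AE_density) auto

lemma distr_input_vector:
  assumes M: "prob_space M" and "I \<noteq> {}" and "prob_space.indep_vars M (\<lambda>_. borel) X I"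
    and "\<And>e. e \<in> I \<Longrightarrow> distr M borel (X e) = P"
  shows "distr M (Pi\<^sub>M I (\<lambda>_. borel)) (input_vector I X) = Pi\<^sub>M I (\<lambda>_. P)"
proof -
  interpret prob_space M by (rule M)
  have rv: "X e \<in> borel_measurable M" if "e \<in> I" for e
    using assms(3) that by (simp add: indep_vars_def)
  have "distr M (Pi\<^sub>M I (\<lambda>_. borel)) (\<lambda>\<omega>. \<lambda>e\<in>I. X e \<omega>) = Pi\<^sub>M I (\<lambda>e. distr M borel (X e))"
    by (rule iffD1[OF indep_vars_iff_distr_eq_PiM'[OF assms(2) rv] assms(3)])
  also have "\<dots> = Pi\<^sub>M I (\<lambda>_. P)" using assms(4) by (intro PiM_cong) auto
  finally show ?thesis by (simp add: input_vector_def[abs_def])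
qed

theorem theorem3p2p4:
  fixes M :: "nat \<Rightarrow> 'w measure"
    and X :: "nat \<Rightarrow> nat \<times> nat \<Rightarrow> 'w \<Rightarrow> real"
    and Y :: "nat \<Rightarrow> nat \<Rightarrow> nat \<times> nat \<Rightarrow> 'w \<Rightarrow> real"
    and P :: "real measure"
    and f \<rho> g :: "real \<Rightarrow> real"
  assumes "prob_space P"
    and "f \<in> borel_measurable borel" and "\<And>x. 0 \<le> f x"
    and "P = density lborel (\<lambda>x. ennreal (f x))"
    and "integrable P (\<lambda>x. x)" and "(\<integral>x. x \<partial>P) = 0"
    and "langevin P \<rho> g"
    and "AE y in gibbs_law \<rho>. deriv g y \<noteq> 0"
    and "sub_gamma_distribution P"
    and "\<And>n. prob_space (M n)"
    and "\<And>n. prob_space.indep_vars (M n) (\<lambda>_. borel) (X n) (sk_edges n)"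
    and "\<And>n e. e \<in> sk_edges n \<Longrightarrow> distr (M n) borel (X n e) = P"
    and "\<And>n i. i \<in> {1..n} \<Longrightarrow> independent_copy (M n) (sk_edges n) (X n) (Y n i)"
  shows "stable_under_small_perturbations M sk_edges sk_spins sk_hamiltonian sk_metric
           (\<lambda>n. {1..n}) sk_block X Y"
proof -
  interpret P: prob_space P by (rule assms(1))
  have sets_P: "sets P = sets borel" using assms(4) by simp
  obtain v c where sg: "sub_gamma P (\<lambda>t. t) v c"
    using assms(9) by (auto simp: sub_gamma_distribution_def)
  have v: "0 \<le> v" using sg by (simp add: sub_gamma_def)
  have atomless: "AE t in P. t \<noteq> c" for c
    unfolding assms(4) by (rule AE_density_lborel_not_point[OF assms(2)])
  have P4: "integrable P (\<lambda>t. t ^ 4)"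
    by (rule sub_gamma_integrable_power4[OF sets_P sg assms(6)])
  have inputs: "centred_inputs P (sk_edges n)" for n
    by unfold_locales (use sets_P finite_sk_edges P4 assms(6) in auto)
  \<comment> \<open>The moment constants depend on \<open>P\<close> only; this instance fixes them
    before \<open>n\<close> is chosen.\<close>
  interpret I: centred_inputs P "sk_edges 0" by (rule inputs)
  define c0 where "c0 = I.l1_const"
  have var: "0 < I.var" by (rule I.var_pos[OF atomless])
  have c0: "0 < c0"
  proof -
    have "0 < I.m4 + 3 * I.var\<^sup>2" using var I.m4_nonneg by (intro add_nonneg_pos) auto
    then show ?thesis unfolding c0_def I.l1_const_def using var
      by (intro mult_pos_pos divide_pos_pos real_sqrt_gt_zero) auto
  qed
  have bound: "\<exists>K::enat. K < \<infinity> \<and> limsup (\<lambda>n. ereal (measure (M n) {\<omega> \<in> space (M n).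
      (INF A \<in> {A. A \<subseteq> {1..n} \<and> real (card A) > (1 - \<epsilon>) * real (card {1..n})}.
        packing_number ((\<lambda>l. arg_min_on (sk_hamiltonian n
          (input_vector (sk_edges n) (perturb (sk_block n l) (X n) (Y n l)) \<omega>)) (sk_spins n)) ` A)
          (sk_metric n) \<epsilon>) \<ge> K})) \<le> ereal \<delta>"
    if \<epsilon>: "0 < \<epsilon>" and \<delta>: "0 < \<delta>" for \<epsilon> \<delta> :: real
  proof -
    \<comment> \<open>All constants are independent of \<open>n\<close>. \<open>K\<close> makes the
      Markov term \<open>\<delta> / 2\<close>, \<open>L\<close> makes
      \<open>2 * C / (c2 * sqrt L)\<close> at most \<open>\<delta> / 2\<close>, and
      \<open>T\<close>, chosen last, makes the total gain at least \<open>2 * K * sqrt n\<close>;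
      one round gains \<open>c2 * sqrt n / sqrt L\<close>.\<close>
    define C where "C = 2 + v"
    define c2 where "c2 = c0 * \<epsilon>\<^sup>2 / sqrt 32"
    define K where "K = 8 * C / (\<epsilon> * \<delta>)"
    define L where "L = nat \<lceil>(4 * C / (c2 * \<delta>))\<^sup>2\<rceil> + 1"
    define T where "T = nat \<lceil>2 * K * sqrt L / c2\<rceil>"
    have C: "0 < C" using v by (simp add: C_def)
    have c2: "0 < c2" using c0 \<epsilon> by (simp add: c2_def)
    have K: "0 < K" using C \<epsilon> \<delta> by (simp add: K_def)
    have L: "0 < L" by (simp add: L_def)
    have "(4 * C / (c2 * \<delta>))\<^sup>2 \<le> real L" unfolding L_def by linarith
    then have sL: "4 * C / (c2 * \<delta>) \<le> sqrt L" by (rule real_le_rsqrt)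
    have T: "2 * K * sqrt L / c2 \<le> real T" unfolding T_def by linarith
    have le: "measure (M n) {\<omega> \<in> space (M n).
      (INF A \<in> {A. A \<subseteq> {1..n} \<and> real (card A) > (1 - \<epsilon>) * real (card {1..n})}.
        packing_number ((\<lambda>l. arg_min_on (sk_hamiltonian n
          (input_vector (sk_edges n) (perturb (sk_block n l) (X n) (Y n l)) \<omega>)) (sk_spins n)) ` A)
          (sk_metric n) \<epsilon>) \<ge> enat (Suc (2 ^ Suc T))} \<le> \<delta>"
      if n: "2 \<le> n" "L \<le> n" "2 * c \<le> sqrt n" for n
    proof -
      interpret centred_inputs P "sk_edges n" by (rule inputs)
      interpret sk_blocks P n L
        by unfold_locales (use n L in auto)
      interpret Mn: prob_space "M n" by (rule assms(10))
      define a where "a = (\<integral>x. opt x \<partial>\<mu>)"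
      define G where "G = measure \<mu> (spread_near_optima T (l1_const * \<epsilon>\<^sup>2 * sqrt (n / (32 * L))) (K * sqrt n))"
      have n0: "0 < real n" "0 < sqrt n" using n by auto
      have a: "a \<le> C * (n * sqrt n)" unfolding a_def C_def by (rule integral_opt_bound[OF sg n(3)])
      let ?x = "input_vector (sk_edges n) (X n)" and ?y = "\<lambda>i. input_vector (sk_edges n) (Y n i)"
      \<comment> \<open>\<open>input_space\<close> and \<open>\<mu>\<close> differ as measures but
        share their sigma-algebra, which is all that a distribution takes from its target.\<close>
      have sets_IS: "sets (input_space (sk_edges n)) = sets \<mu>" by (simp add: input_space_def sets_mu)
      have "(1, 2) \<in> sk_edges n" using n by (simp add: sk_edges_def)
      then have "distr (M n) (Pi\<^sub>M (sk_edges n) (\<lambda>_. borel)) ?x = \<mu>"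
        by (intro distr_input_vector assms(10,11,12)) auto
      then have law_IS: "distr (M n) (input_space (sk_edges n)) ?x = \<mu>" by (simp add: input_space_def)
      then have law_x: "distr (M n) \<mu> ?x = \<mu>"
        using distr_cong[OF refl sets_IS] by (metis (no_types, lifting))
      have pair: "?x \<in> measurable (M n) \<mu> \<and> ?y i \<in> measurable (M n) \<mu> \<and>
          distr (M n) (\<mu> \<Otimes>\<^sub>M \<mu>) (\<lambda>\<omega>. (?x \<omega>, ?y i \<omega>)) = \<mu> \<Otimes>\<^sub>M \<mu>" if i: "i \<in> {1..n}" for i
      proof -
        let ?N = "input_space (sk_edges n)"
        have ind: "Mn.indep_var ?N ?x ?N (?y i)" and "distr (M n) ?N (?y i) = distr (M n) ?N ?x"
          using assms(13)[OF i] by (auto simp: independent_copy_def)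
        then have rv: "?x \<in> measurable (M n) ?N" "?y i \<in> measurable (M n) ?N"
          and "distr (M n) (?N \<Otimes>\<^sub>M ?N) (\<lambda>\<omega>. (?x \<omega>, ?y i \<omega>)) = \<mu> \<Otimes>\<^sub>M \<mu>"
          using Mn.indep_var_distribution_eq[of ?N ?x ?N "?y i"] law_IS by auto
        moreover have "distr (M n) (\<mu> \<Otimes>\<^sub>M \<mu>) (\<lambda>\<omega>. (?x \<omega>, ?y i \<omega>)) = distr (M n) (?N \<Otimes>\<^sub>M ?N) (\<lambda>\<omega>. (?x \<omega>, ?y i \<omega>))"
          by (intro distr_cong sets_pair_measure_cong) (simp_all add: sets_IS)
        moreover have "measurable (M n) ?N = measurable (M n) \<mu>"
          by (rule measurable_cong_sets[OF refl sets_IS])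
        ultimately show ?thesis by simp
      qed
      have resampled: "input_vector (sk_edges n) (perturb (sk_block n i) (X n) (Y n i)) \<omega>
          = resample (sk_block n i) (?x \<omega>) (?y i \<omega>)" for i \<omega>
        by (auto simp: input_vector_def perturb_def resample_def fun_eq_iff)
      have l1: "l1_const = c0"
        unfolding c0_def l1_const_def I.l1_const_def var_def I.var_def m4_def I.m4_def ..
      have var_n: "0 < var" using var unfolding var_def I.var_def .
      have "measure (M n) {\<omega> \<in> space (M n).
      enat (Suc (2 ^ Suc T)) \<le> (INF A \<in> {A. A \<subseteq> {1..n} \<and> real (card A) > (1 - \<epsilon>) * real (card {1..n})}.
        packing_number ((\<lambda>l. arg_min_on (sk_hamiltonian n
          (input_vector (sk_edges n) (perturb (sk_block n l) (X n) (Y n l)) \<omega>)) (sk_spins n)) ` A)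
          (sk_metric n) \<epsilon>)} \<le> 4 * a / (\<epsilon> * n * (K * sqrt n)) + G"
        unfolding resampled a_def G_def
        by (rule instability_bound[OF assms(10) var_n atomless _ law_x _ _ \<epsilon>])
          (use pair[of 1] pair K n0 n in auto)
      also have "4 * a / (\<epsilon> * n * (K * sqrt n)) \<le> 4 * (C * (n * sqrt n)) / (\<epsilon> * n * (K * sqrt n))"
        using a \<epsilon> K n0 by (intro divide_right_mono mult_left_mono) auto
      also have "\<dots> = \<delta> / 2"
        using \<epsilon> \<delta> C n0 by (simp add: K_def field_simps)
      also have "G \<le> \<delta> / 2"
      proof -
        define g where "g = c2 * sqrt n / sqrt L"
        have sL0: "0 < sqrt L" using L by simp
        have g: "l1_const * \<epsilon>\<^sup>2 * sqrt (n / (32 * L)) = g"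
          by (simp add: l1 g_def c2_def real_sqrt_divide real_sqrt_mult)
        have card: "real (card ({1..n} \<times> {..<L})) = n * L" by simp
        have G1: "G * (T * g - K * sqrt n) \<le> T * a / (n * L)"
          using prob_spread_near_optima[of T g "K * sqrt n"] unfolding G_def g a_def card .
        have "2 * K * sqrt L \<le> T * c2" using T c2 by (simp add: field_simps)
        then have "2 * (K * sqrt n) * sqrt L \<le> T * (c2 * sqrt n)"
          using n0 mult_right_mono[of "2 * K * sqrt L" "T * c2" "sqrt n"] by (simp add: mult_ac)
        then have Tg: "2 * (K * sqrt n) \<le> T * g"
          using sL0 by (simp add: g_def field_simps)
        have "0 < T * g" using Tg K n0 by (smt (verit) mult_pos_pos)
        \<comment> \<open>Half of the total gain covers the distance from the optimum; in the other
          half \<open>T\<close> cancels against the \<open>T\<close> shares of the cost.\<close>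
        have "T * g / 2 \<le> T * g - K * sqrt n" using Tg by linarith
        then have "G * (T * g / 2) \<le> G * (T * g - K * sqrt n)"
          by (rule mult_left_mono) (simp add: G_def)
        also note G1
        also have "T * a / (n * L) \<le> T * (C * (n * sqrt n)) / (n * L)"
          using a by (intro divide_right_mono mult_left_mono) auto
        also have "\<dots> = (T * g / 2) * (2 * C / (c2 * sqrt L))"
        proof -
          have "real L = sqrt L * sqrt L" by simp
          then show ?thesis using n0 sL0 c2 by (simp add: g_def field_simps)
        qed
        finally have "(T * g / 2) * G \<le> (T * g / 2) * (2 * C / (c2 * sqrt L))"
          unfolding mult.commute[of G] .
        then have "G \<le> 2 * C / (c2 * sqrt L)"
          by (rule mult_left_le_imp_le) (use \<open>0 < T * g\<close> in simp)
        also have "\<dots> \<le> \<delta> / 2"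
          using sL c2 \<delta> sL0 by (simp add: field_simps)
        finally show ?thesis .
      qed
      finally show ?thesis by simp
    qed
    have "eventually (\<lambda>n. 2 \<le> n \<and> L \<le> n \<and> 2 * c \<le> sqrt n) sequentially"
    proof -
      have "eventually (\<lambda>n. 2 * c \<le> sqrt (real n)) sequentially"
        using filterlim_compose[OF sqrt_at_top filterlim_real_sequentially] by (simp add: filterlim_at_top)
      then show ?thesis
        using eventually_ge_at_top[of "2::nat"] eventually_ge_at_top[of L] by eventually_elim auto
    qed
    then have "limsup (\<lambda>n. ereal (measure (M n) {\<omega> \<in> space (M n).
      (INF A \<in> {A. A \<subseteq> {1..n} \<and> real (card A) > (1 - \<epsilon>) * real (card {1..n})}.
        packing_number ((\<lambda>l. arg_min_on (sk_hamiltonian n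
          (input_vector (sk_edges n) (perturb (sk_block n l) (X n) (Y n l)) \<omega>)) (sk_spins n)) ` A)
          (sk_metric n) \<epsilon>) \<ge> enat (Suc (2 ^ Suc T))})) \<le> ereal \<delta>"
      using le by (intro Limsup_bounded) (auto elim: eventually_mono)
    then show ?thesis by (intro exI[of _ "enat (Suc (2 ^ Suc T))"]) simp
  qed
  show ?thesis
    unfolding stable_under_small_perturbations_def
    using bound union_sk_block by (intro conjI allI impI) simp_all
qed

end
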